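(* Let $\Phi=(A;E_0,\ldots,E_d;A^*;E^*_0,\ldots,E^*_d)$ be a Leonard system in $\mathcal A$, with irreducible left $\mathcal A$-module $V$. Let $g=wxyz\in S_4$, and let $A^g$, $A^{*g}$ be the matrices representing $A$, $A^*$ with respect to the basis $\lbrack g\rbrack$ of $V$. Then: (1) if $y\notin\{0^*,d^*\}$ and $z\notin\{0^*,d^*\}$, then $A^g$ is diagonal and $A^{*g}$ is irreducible tridiagonal; (2) if $y\in\{0^*,d^*\}$ and $z\notin\{0^*,d^*\}$, then $A^g$ is lower bidiagonal and $A^{*g}$ is upper bidiagonal; (3) if $y\notin\{0^*,d^*\}$ and $z\in\{0^*,d^*\}$, then $A^g$ is upper bidiagonal and $A^{*g}$ is lower bidiagonal; (4) if $y\in\{0^*,d^*\}$ and $z\in\{0^*,d^*\}$, then $A^g$ is irreducible tridiagonal and $A^{*g}$ is diagonal. The numbers of elements of $S_4$ satisfying cases (1), (2), (3), (4) are $4,8,8,4$, respectively.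
   Context: Let $\mathbb K$ be an arbitrary field and $d\ge 0$ an integer. $\mathrm{Mat}_{d+1}(\mathbb K)$ is the $\mathbb K$-algebra of $(d+1)\times(d+1)$ matrices over $\mathbb K$, rows and columns indexed by $0,1,\ldots,d$; $\mathcal A$ is a $\mathbb K$-algebra isomorphic to it, with identity $I$. An element of $\mathcal A$ is multiplicity-free if it has $d+1$ distinct eigenvalues (roots of its minimal polynomial), all in $\mathbb K$. If $X\in\mathcal A$ is multiplicity-free with eigenvalues $\xi_0,\ldots,\xi_d$, the primitive idempotent of $X$ associated with $\xi_i$ is $\prod_{j\ne i}(X-\xi_jI)/(\xi_i-\xi_j)$. A Leonard system in $\mathcal A$ is a sequence $\Phi=(A;E_0,\ldots,E_d;A^*;E^*_0,\ldots,E^*_d)$ such that: (i) $A,A^*\in\mathcal A$ are both multiplicity-free; (ii) $E_0,\ldots,E_d$ is an ordering of the primitive idempotents of $A$; (iii) $E^*_0,\ldots,E^*_d$ is an ordering of the primitive idempotents of $A^*$; (iv) $E_iA^*E_j$ is $0$ if $|i-j|>1$ and nonzero if $|i-j|=1$; (v) $E^*_iAE^*_j$ is $0$ if $|i-j|>1$ and nonzero if $|i-j|=1$ ($0\le i,j\le d$). ($A^*$ is just a name, not a conjugate-transpose.) $\theta_i$ (resp. $\theta^*_i$) denotes the eigenvalue of $A$ (resp. $A^*$) associated with $E_i$ (resp. $E^*_i$). The irreducible left $\mathcal A$-module $V$ has dimension $d+1$. $S_4$ is identified with the set of linear orderings $wxyz$ of the four symbols $0,d,0^*,d^*$. The 24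 bases. Fix nonzero vectors $\eta_0\in E_0V$, $\eta_d\in E_dV$, $\eta^*_0\in E^*_0V$, $\eta^*_d\in E^*_dV$. For $0\le i\le d$ put $\tau_i=\prod_{h=0}^{i-1}(A-\theta_hI)$, $\sigma_i=\prod_{h=d-i+1}^{d}(A-\theta_hI)$, $\tau^*_i=\prod_{h=0}^{i-1}(A^*-\theta^*_hI)$, $\sigma^*_i=\prod_{h=d-i+1}^{d}(A^*-\theta^*_hI)$ (empty products are $I$). For $g\in S_4$, $\lbrack g\rbrack$ is the ordered basis $v_0,\ldots,v_d$ of $V$ with $v_i$ as follows: $d^*00^*d$: $\tau_i\eta^*_0$; $0d^*0^*d$: $\sigma^*_{d-i}\eta_d$; $d^*0d0^*$: $\tau_{d-i}\eta^*_0$; $0d^*d0^*$: $\sigma^*_i\eta_d$; $d0^*0d^*$: $\tau^*_i\eta_0$; $0^*d0d^*$: $\sigma_{d-i}\eta^*_d$; $d0^*d^*0$: $\tau^*_{d-i}\eta_0$; $0^*dd^*0$: $\sigma_i\eta^*_d$; $dd^*00^*$: $\sigma^*_i\eta_0$; $d^*d00^*$: $\sigma_{d-i}\eta^*_0$; $dd^*0^*0$: $\sigma^*_{d-i}\eta_0$; $d^*d0^*0$: $\sigma_i\eta^*_0$; $00^*dd^*$: $\tau^*_i\eta_d$; $0^*0dd^*$: $\tau_{d-i}\eta^*_d$; $00^*d^*d$: $\tau^*_{d-i}\eta_d$; $0^*0d^*d$: $\tau_i\eta^*_d$; $d^*0^*0d$: $E_i\eta^*_0$; $0^*d^*0d$: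 $E_i\eta^*_d$; $d^*0^*d0$: $E_{d-i}\eta^*_0$; $0^*d^*d0$: $E_{d-i}\eta^*_d$; $d00^*d^*$: $E^*_i\eta_0$; $0d0^*d^*$: $E^*_i\eta_d$; $d0d^*0^*$: $E^*_{d-i}\eta_0$; $0dd^*0^*$: $E^*_{d-i}\eta_d$. (It is known that each of these sequences is a basis for $V$.) For $X\in\mathcal A$, $X^g$ is the matrix with $Xv_j=\sum_{i=0}^dX^g_{ij}v_i$, where $\lbrack g\rbrack=(v_0,\ldots,v_d)$. A tridiagonal matrix is irreducible if all entries immediately above and immediately below the main diagonal are nonzero. A square matrix is lower bidiagonal if all its nonzero entries lie on or immediately below the main diagonal; it is upper bidiagonal if its transpose is lower bidiagonal. *)

theory Defs
  imports "HOL-Computational_Algebra.Polynomial" "Jordan_Normal_Form.Matrix"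
begin

text \<open>A \<open>\<bbbK>\<close>-algebra is a type of class \<open>ring_1\<close> with an explicit scalar multiplication by a
  field; the field acts on a left module \<open>V\<close> of the algebra through \<open>c \<mapsto> c 1\<close>.\<close>

definition field_algebra :: "('k::field \<Rightarrow> 'a::ring_1 \<Rightarrow> 'a) \<Rightarrow> bool" where
  "field_algebra scale \<longleftrightarrow>
     vector_space scale \<and>
     (\<forall>c X Y. scale c X * Y = scale c (X * Y) \<and> X * scale c Y = scale c (X * Y))"

definition full_matrix_algebra :: "nat \<Rightarrow> ('k::field \<Rightarrow> 'a::ring_1 \<Rightarrow> 'a) \<Rightarrow> bool" where
  "full_matrix_algebra d scale \<longleftrightarrow>
     field_algebra scale \<and>
     (\<exists>\<phi> :: 'a \<Rightarrow> 'k mat.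
        bij_betw \<phi> UNIV (carrier_mat (d + 1) (d + 1)) \<and>
        \<phi> 1 = 1\<^sub>m (d + 1) \<and>
        (\<forall>X Y. \<phi> (X + Y) = \<phi> X + \<phi> Y) \<and>
        (\<forall>X Y. \<phi> (X * Y) = \<phi> X * \<phi> Y) \<and>
        (\<forall>c X. \<phi> (scale c X) = c \<cdot>\<^sub>m \<phi> X))"

definition left_module :: "('a::ring_1 \<Rightarrow> 'v::ab_group_add \<Rightarrow> 'v) \<Rightarrow> bool" where
  "left_module act \<longleftrightarrow>
     (\<forall>X u v. act X (u + v) = act X u + act X v) \<and>
     (\<forall>X Y v. act (X + Y) v = act X v + act Y v) \<and>
     (\<forall>X Y v. act (X * Y) v = act X (act Y v)) \<and>
     (\<forall>v. act 1 v = v)"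

definition left_submodule :: "('a::ring_1 \<Rightarrow> 'v::ab_group_add \<Rightarrow> 'v) \<Rightarrow> 'v set \<Rightarrow> bool" where
  "left_submodule act W \<longleftrightarrow>
     0 \<in> W \<and> (\<forall>u\<in>W. \<forall>v\<in>W. u + v \<in> W) \<and> (\<forall>X. \<forall>v\<in>W. act X v \<in> W)"

definition irreducible_left_module :: "('a::ring_1 \<Rightarrow> 'v::ab_group_add \<Rightarrow> 'v) \<Rightarrow> bool" where
  "irreducible_left_module act \<longleftrightarrow>
     left_module act \<and> (UNIV :: 'v set) \<noteq> {0} \<and>
     (\<forall>W. left_submodule act W \<longrightarrow> W = {0} \<or> W = UNIV)"

definition poly_eval :: "('k::field \<Rightarrow> 'a::ring_1 \<Rightarrow> 'a) \<Rightarrow> 'k poly \<Rightarrow> 'a \<Rightarrow> 'a" where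
  "poly_eval scale p X = (\<Sum>i\<le>degree p. scale (coeff p i) (X ^ i))"

definition min_poly :: "('k::field \<Rightarrow> 'a::ring_1 \<Rightarrow> 'a) \<Rightarrow> 'a \<Rightarrow> 'k poly" where
  "min_poly scale X =
     (THE p. lead_coeff p = 1 \<and> poly_eval scale p X = 0 \<and>
        (\<forall>q. q \<noteq> 0 \<and> poly_eval scale q X = 0 \<longrightarrow> degree p \<le> degree q))"

definition eigenvalues :: "('k::field \<Rightarrow> 'a::ring_1 \<Rightarrow> 'a) \<Rightarrow> 'a \<Rightarrow> 'k set" where
  "eigenvalues scale X = {\<xi>. poly (min_poly scale X) \<xi> = 0}"

text \<open>The set \<open>eigenvalues\<close> only contains the roots in \<open>\<bbbK>\<close>. That every root of the minimal
  polynomial lies in \<open>\<bbbK>\<close> is the first conjunct of the next definition.\<close>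

definition multiplicity_free :: "nat \<Rightarrow> ('k::field \<Rightarrow> 'a::ring_1 \<Rightarrow> 'a) \<Rightarrow> 'a \<Rightarrow> bool" where
  "multiplicity_free d scale X \<longleftrightarrow>
     (\<exists>\<xi>s. min_poly scale X = (\<Prod>\<xi>\<leftarrow>\<xi>s. [:- \<xi>, 1:])) \<and>
     card (eigenvalues scale X) = d + 1"

text \<open>The algebra is not commutative, so the product of the factors
  \<open>(X - \<zeta> I) / (\<xi> - \<zeta>)\<close> over the set of the other eigenvalues is formed in the polynomial ring
  and then evaluated at \<open>X\<close>.\<close>

definition primitive_idempotent ::
  "('k::field \<Rightarrow> 'a::ring_1 \<Rightarrow> 'a) \<Rightarrow> 'a \<Rightarrow> 'k \<Rightarrow> 'a" where
  "primitive_idempotent scale X \<xi> =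
     poly_eval scale
       (\<Prod>\<zeta>\<in>eigenvalues scale X - {\<xi>}. Polynomial.smult (1 / (\<xi> - \<zeta>)) [:- \<zeta>, 1:]) X"

definition associated_eigenvalue ::
  "('k::field \<Rightarrow> 'a::ring_1 \<Rightarrow> 'a) \<Rightarrow> 'a \<Rightarrow> 'a \<Rightarrow> 'k" where
  "associated_eigenvalue scale X e =
     (THE \<xi>. \<xi> \<in> eigenvalues scale X \<and> primitive_idempotent scale X \<xi> = e)"

text \<open>In sequences indexed by \<open>0, \<dots>, d\<close>, encoded as functions on \<open>nat\<close>, the values beyond \<open>d\<close>
  are irrelevant.\<close>

definition idempotent_ordering ::
  "nat \<Rightarrow> ('k::field \<Rightarrow> 'a::ring_1 \<Rightarrow> 'a) \<Rightarrow> 'a \<Rightarrow> (nat \<Rightarrow> 'a) \<Rightarrow> bool" where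
  "idempotent_ordering d scale X E \<longleftrightarrow>
     bij_betw E {0..d} (primitive_idempotent scale X ` eigenvalues scale X)"

definition leonard_system ::
  "nat \<Rightarrow> ('k::field \<Rightarrow> 'a::ring_1 \<Rightarrow> 'a) \<Rightarrow> 'a \<Rightarrow> (nat \<Rightarrow> 'a) \<Rightarrow> 'a \<Rightarrow> (nat \<Rightarrow> 'a) \<Rightarrow> bool" where
  "leonard_system d scale A E As Es \<longleftrightarrow>
     multiplicity_free d scale A \<and> multiplicity_free d scale As \<and>
     idempotent_ordering d scale A E \<and>
     idempotent_ordering d scale As Es \<and>
     (\<forall>i\<in>{0..d}. \<forall>j\<in>{0..d}.
        (\<bar>int i - int j\<bar> > 1 \<longrightarrow> E i * As * E j = 0) \<and>
        (\<bar>int i - int j\<bar> = 1 \<longrightarrow> E i * As * E j \<noteq> 0)) \<and>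
     (\<forall>i\<in>{0..d}. \<forall>j\<in>{0..d}.
        (\<bar>int i - int j\<bar> > 1 \<longrightarrow> Es i * A * Es j = 0) \<and>
        (\<bar>int i - int j\<bar> = 1 \<longrightarrow> Es i * A * Es j \<noteq> 0))"

text \<open>\<open>tau\<close> and \<open>sigma\<close> give \<open>\<tau>\<close> and \<open>\<sigma>\<close> for \<open>X = A\<close>, and \<open>\<tau>\<^sup>*\<close> and \<open>\<sigma>\<^sup>*\<close> for
  \<open>X = A\<^sup>*\<close>; \<open>\<theta>\<close> is the respective sequence of eigenvalues.\<close>

definition tau :: "('k::field \<Rightarrow> 'a::ring_1 \<Rightarrow> 'a) \<Rightarrow> (nat \<Rightarrow> 'k) \<Rightarrow> 'a \<Rightarrow> nat \<Rightarrow> 'a" where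
  "tau scale \<theta> X i = (\<Prod>h\<leftarrow>[0..<i]. X - scale (\<theta> h) 1)"

definition sigma ::
  "nat \<Rightarrow> ('k::field \<Rightarrow> 'a::ring_1 \<Rightarrow> 'a) \<Rightarrow> (nat \<Rightarrow> 'k) \<Rightarrow> 'a \<Rightarrow> nat \<Rightarrow> 'a" where
  "sigma d scale \<theta> X i = (\<Prod>h\<leftarrow>[d - i + 1..<d + 1]. X - scale (\<theta> h) 1)"

text \<open>The four symbols \<open>0\<close>, \<open>d\<close>, \<open>0\<^sup>*\<close>, \<open>d\<^sup>*\<close>.\<close>

datatype symb = S0 | Sd | S0s | Sds

text \<open>The linear ordering \<open>wxyz\<close> is the tuple \<open>(w, x, y, z)\<close>.\<close>

definition S4 :: "(symb \<times> symb \<times> symb \<times> symb) set" where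
  "S4 = {(w, x, y, z). distinct [w, x, y, z]}"

text \<open>Vector number \<open>i\<close> of the basis \<open>[g]\<close>, for \<open>g \<in> S4\<close> and \<open>i \<le> d\<close>; the vectors \<open>\<eta>0\<close>,
  \<open>\<eta>d\<close>, \<open>\<eta>0s\<close>, \<open>\<eta>ds\<close> are those chosen in \<open>E\<^sub>0V\<close>, \<open>E\<^sub>dV\<close>, \<open>E\<^sup>*\<^sub>0V\<close>, \<open>E\<^sup>*\<^sub>dV\<close>.\<close>

definition basis_vec ::
  "nat \<Rightarrow> ('k::field \<Rightarrow> 'a::ring_1 \<Rightarrow> 'a) \<Rightarrow> ('a \<Rightarrow> 'v::ab_group_add \<Rightarrow> 'v) \<Rightarrow>
   'a \<Rightarrow> (nat \<Rightarrow> 'a) \<Rightarrow> 'a \<Rightarrow> (nat \<Rightarrow> 'a) \<Rightarrow> 'v \<Rightarrow> 'v \<Rightarrow> 'v \<Rightarrow> 'v \<Rightarrow>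
   symb \<times> symb \<times> symb \<times> symb \<Rightarrow> nat \<Rightarrow> 'v" where
  "basis_vec d scale act A E As Es \<eta>0 \<eta>d \<eta>0s \<eta>ds g i =
    (let \<theta> = (\<lambda>h. associated_eigenvalue scale A (E h));
         \<theta>s = (\<lambda>h. associated_eigenvalue scale As (Es h));
         \<tau> = tau scale \<theta> A;
         \<sigma> = sigma d scale \<theta> A;
         \<tau>s = tau scale \<theta>s As;
         \<sigma>s = sigma d scale \<theta>s As
     in case g of
       (Sds, S0, S0s, Sd) \<Rightarrow> act (\<tau> i) \<eta>0s
     | (S0, Sds, S0s, Sd) \<Rightarrow> act (\<sigma>s (d - i)) \<eta>d
     | (Sds, S0, Sd, S0s) \<Rightarrow> act (\<tau> (d - i)) \<eta>0s
     | (S0, Sds, Sd, S0s) \<Rightarrow> act (\<sigma>s i) \<eta>d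
     | (Sd, S0s, S0, Sds) \<Rightarrow> act (\<tau>s i) \<eta>0
     | (S0s, Sd, S0, Sds) \<Rightarrow> act (\<sigma> (d - i)) \<eta>ds
     | (Sd, S0s, Sds, S0) \<Rightarrow> act (\<tau>s (d - i)) \<eta>0
     | (S0s, Sd, Sds, S0) \<Rightarrow> act (\<sigma> i) \<eta>ds
     | (Sd, Sds, S0, S0s) \<Rightarrow> act (\<sigma>s i) \<eta>0
     | (Sds, Sd, S0, S0s) \<Rightarrow> act (\<sigma> (d - i)) \<eta>0s
     | (Sd, Sds, S0s, S0) \<Rightarrow> act (\<sigma>s (d - i)) \<eta>0
     | (Sds, Sd, S0s, S0) \<Rightarrow> act (\<sigma> i) \<eta>0s
     | (S0, S0s, Sd, Sds) \<Rightarrow> act (\<tau>s i) \<eta>d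
     | (S0s, S0, Sd, Sds) \<Rightarrow> act (\<tau> (d - i)) \<eta>ds
     | (S0, S0s, Sds, Sd) \<Rightarrow> act (\<tau>s (d - i)) \<eta>d
     | (S0s, S0, Sds, Sd) \<Rightarrow> act (\<tau> i) \<eta>ds
     | (Sds, S0s, S0, Sd) \<Rightarrow> act (E i) \<eta>0s
     | (S0s, Sds, S0, Sd) \<Rightarrow> act (E i) \<eta>ds
     | (Sds, S0s, Sd, S0) \<Rightarrow> act (E (d - i)) \<eta>0s
     | (S0s, Sds, Sd, S0) \<Rightarrow> act (E (d - i)) \<eta>ds
     | (Sd, S0, S0s, Sds) \<Rightarrow> act (Es i) \<eta>0
     | (S0, Sd, S0s, Sds) \<Rightarrow> act (Es i) \<eta>d
     | (Sd, S0, Sds, S0s) \<Rightarrow> act (Es (d - i)) \<eta>0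
     | (S0, Sd, Sds, S0s) \<Rightarrow> act (Es (d - i)) \<eta>d
     | _ \<Rightarrow> undefined)"

definition rep_matrix ::
  "nat \<Rightarrow> ('k::field \<Rightarrow> 'a::ring_1 \<Rightarrow> 'a) \<Rightarrow> ('a \<Rightarrow> 'v::ab_group_add \<Rightarrow> 'v) \<Rightarrow>
   (nat \<Rightarrow> 'v) \<Rightarrow> 'a \<Rightarrow> 'k mat" where
  "rep_matrix d scale act v X =
     (THE M. M \<in> carrier_mat (d + 1) (d + 1) \<and>
        (\<forall>j\<in>{0..d}. act X (v j) = (\<Sum>i=0..d. act (scale (M $$ (i, j)) 1) (v i))))"

definition tridiagonal :: "'k::zero mat \<Rightarrow> bool" where
  "tridiagonal M \<longleftrightarrow>
     (\<forall>i<dim_row M. \<forall>j<dim_col M. \<bar>int i - int j\<bar> > 1 \<longrightarrow> M $$ (i, j) = 0)"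

definition irreducible_tridiagonal :: "'k::zero mat \<Rightarrow> bool" where
  "irreducible_tridiagonal M \<longleftrightarrow>
     tridiagonal M \<and>
     (\<forall>i<dim_row M. \<forall>j<dim_col M. \<bar>int i - int j\<bar> = 1 \<longrightarrow> M $$ (i, j) \<noteq> 0)"

definition lower_bidiagonal :: "'k::zero mat \<Rightarrow> bool" where
  "lower_bidiagonal M \<longleftrightarrow>
     (\<forall>i<dim_row M. \<forall>j<dim_col M. M $$ (i, j) \<noteq> 0 \<longrightarrow> i = j \<or> i = j + 1)"

definition upper_bidiagonal :: "'k::zero mat \<Rightarrow> bool" where
  "upper_bidiagonal M \<longleftrightarrow> lower_bidiagonal (transpose_mat M)"

end

theory Submission
  imports Defs
begin

text \<open>Let \<open>P\<^sub>i\<close> and \<open>Q\<^sub>i\<close> be the projections of \<open>V\<close> given by \<open>E\<^sub>i\<close> and \<open>E\<^sup>*\<^sub>i\<close>. The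
  space \<open>V\<close> is spanned by \<open>d + 1\<close> vectors and is a faithful module, so the \<open>P\<^sub>i V\<close> are lines whose
  sum is direct and equal to \<open>V\<close>. A nonzero \<open>\<eta> \<in> Q\<^sub>0 V\<close> is cyclic for \<open>A\<close>, hence has a nonzero
  component in every \<open>P\<^sub>i V\<close>; this gives the eigenbases \<open>P\<^sub>i \<eta>\<close>. The vectors \<open>v\<^sub>i = \<tau>\<^sub>i \<eta>\<close> lie in
  \<open>(P\<^sub>i V + \<dots> + P\<^sub>d V) \<inter> (Q\<^sub>0 V + \<dots> + Q\<^sub>i V)\<close> and have nonzero \<open>P\<^sub>i\<close> and \<open>Q\<^sub>i\<close> components;
  these triangularity properties alone force both matrices to be bidiagonal. Reversing the order of
  the \<open>E\<^sub>i\<close>, reversing the order of the \<open>E\<^sup>*\<^sub>i\<close> and exchanging \<open>A\<close> with \<open>A\<^sup>*\<close> preserve Leonard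
  systems, so the 24 bases fall into four families of six, one for each end vector, and it suffices
  to treat \<open>\<eta>\<^sup>*\<^sub>0\<close>.\<close>

section \<open>Families of vectors triangular with respect to a sequence of projections\<close>

definition triangular :: "nat \<Rightarrow> (nat \<Rightarrow> 'v \<Rightarrow> 'v) \<Rightarrow> (nat \<Rightarrow> 'v::zero) \<Rightarrow> bool" where
  "triangular d P v \<longleftrightarrow> (\<forall>i\<le>d. P i (v i) \<noteq> 0 \<and> (\<forall>h<i. P h (v i) = 0))"

text \<open>The second half unfolds to: \<open>Q k (v k)\<close> is nonzero and
  \<open>Q l (v k)\<close> vanishes for \<open>k < l \<le> d\<close>. Phrasing it through
  \<open>triangular\<close> with reversed indices makes every fact about triangular families
  available for \<open>Q\<close> too. For a Leonard pair these are the bases adapted to the split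
  decomposition.\<close>

definition split_basis ::
  "nat \<Rightarrow> (nat \<Rightarrow> 'v \<Rightarrow> 'v) \<Rightarrow> (nat \<Rightarrow> 'v \<Rightarrow> 'v) \<Rightarrow> (nat \<Rightarrow> 'v::zero) \<Rightarrow> bool" where
  "split_basis d P Q v \<longleftrightarrow>
     triangular d P v \<and> triangular d (\<lambda>i. Q (d - i)) (\<lambda>i. v (d - i))"

text \<open>When each \<open>P i\<close> has rank one, the nonvanishing for all \<open>x\<close> with \<open>P j x \<noteq> 0\<close> amounts to
  \<open>P i \<circ> f \<circ> P j \<noteq> 0\<close>.\<close>

definition tridiagonal_action ::
  "nat \<Rightarrow> ('v \<Rightarrow> 'v) \<Rightarrow> (nat \<Rightarrow> 'v \<Rightarrow> 'v::zero) \<Rightarrow> bool" where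
  "tridiagonal_action d f P \<longleftrightarrow>
     (\<forall>i\<le>d. \<forall>j\<le>d. \<forall>x.
        (Suc i < j \<or> Suc j < i \<longrightarrow> P i (f (P j x)) = 0) \<and>
        (i = Suc j \<or> j = Suc i \<longrightarrow> P j x \<noteq> 0 \<longrightarrow> P i (f (P j x)) \<noteq> 0))"

text \<open>The counterpart of \<open>rep_matrix\<close> for a bare operator \<open>f\<close>, so
  that the linear algebra can be done without the algebra.\<close>

definition matrix_of ::
  "nat \<Rightarrow> ('k::field \<Rightarrow> 'v::ab_group_add \<Rightarrow> 'v) \<Rightarrow> (nat \<Rightarrow> 'v) \<Rightarrow> ('v \<Rightarrow> 'v) \<Rightarrow> 'k mat" where
  "matrix_of d sc v f =
     (THE M. M \<in> carrier_mat (d + 1) (d + 1) \<and>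
        (\<forall>j\<in>{0..d}. f (v j) = (\<Sum>i=0..d. sc (M $$ (i, j)) (v i))))"

lemma split_basis_reverse:
  assumes "split_basis d P Q v"
  shows "split_basis d (\<lambda>i. Q (d - i)) (\<lambda>i. P (d - i)) (\<lambda>i. v (d - i))"
  using assms by (auto simp: split_basis_def triangular_def)

lemma tridiagonal_action_reverse:
  assumes "tridiagonal_action d f P"
  shows "tridiagonal_action d f (\<lambda>i. P (d - i))"
proof -
  have *: "Suc i < j \<or> Suc j < i \<longleftrightarrow> Suc (d - i) < d - j \<or> Suc (d - j) < d - i"
    "i = Suc j \<or> j = Suc i \<longleftrightarrow> d - i = Suc (d - j) \<or> d - j = Suc (d - i)"
    if "i \<le> d" "j \<le> d" for i j
    using that by auto
  show ?thesis
    unfolding tridiagonal_action_def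
  proof (intro allI impI)
    fix i j x assume ij: "i \<le> d" "j \<le> d"
    show "(Suc i < j \<or> Suc j < i \<longrightarrow> P (d - i) (f (P (d - j) x)) = 0) \<and>
        (i = Suc j \<or> j = Suc i \<longrightarrow> P (d - j) x \<noteq> 0 \<longrightarrow> P (d - i) (f (P (d - j) x)) \<noteq> 0)"
      unfolding *[OF ij]
      by (rule assms[unfolded tridiagonal_action_def, rule_format]) simp_all
  qed
qed

text \<open>The spectral data of a diagonalizable operator with \<open>d + 1\<close> distinct
  eigenvalues and one-dimensional eigenspaces. Instead of dimensions, \<open>proj_rank_one\<close>
  and \<open>proj_nonzero\<close> express that each projection has rank one.\<close>

locale spectral_resolution = vector_space sc
  for sc :: "'k::field \<Rightarrow> 'v::ab_group_add \<Rightarrow> 'v" +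
  fixes d :: nat and a :: "'v \<Rightarrow> 'v" and \<theta> :: "nat \<Rightarrow> 'k" and P :: "nat \<Rightarrow> 'v \<Rightarrow> 'v"
  assumes hom_op: "module_hom sc sc a"
    and hom_proj: "i \<le> d \<Longrightarrow> module_hom sc sc (P i)"
    and proj_op: "i \<le> d \<Longrightarrow> P i (a x) = sc (\<theta> i) (P i x)"
    and inj_eigenvalues: "inj_on \<theta> {..d}"
    and proj_proj: "i \<le> d \<Longrightarrow> j \<le> d \<Longrightarrow> P i (P j x) = (if i = j then P i x else 0)"
    and sum_proj: "(\<Sum>i=0..d. P i x) = x"
    and proj_rank_one: "i \<le> d \<Longrightarrow> P i x \<noteq> 0 \<Longrightarrow> \<exists>c. P i y = sc c (P i x)"
    and proj_nonzero: "i \<le> d \<Longrightarrow> \<exists>x. P i x \<noteq> 0"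
begin

lemma reverse: "spectral_resolution sc d a (\<lambda>i. \<theta> (d - i)) (\<lambda>i. P (d - i))"
proof (intro spectral_resolution.intro spectral_resolution_axioms.intro vector_space_axioms)
  show "(\<Sum>i=0..d. P (d - i) x) = x" for x
    using sum_proj[of x] sum.atLeastAtMost_rev[of "\<lambda>i. P i x" 0 d] by simp
  show "inj_on (\<lambda>i. \<theta> (d - i)) {..d}"
  proof (rule inj_onI)
    fix i j assume "i \<in> {..d}" "j \<in> {..d}" "\<theta> (d - i) = \<theta> (d - j)"
    then show "i = j"
      using inj_onD[OF inj_eigenvalues, of "d - i" "d - j"] by auto
  qed
  show "\<exists>c. P (d - i) y = sc c (P (d - i) x)" if "i \<le> d" "P (d - i) x \<noteq> 0" for i x y
    using proj_rank_one[of "d - i"] that by simp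
  show "P (d - i) (P (d - j) x) = (if i = j then P (d - i) x else 0)"
    if "i \<le> d" "j \<le> d" for i j x
    using that proj_proj[of "d - i" "d - j" x] by (cases "i = j") auto
qed (simp_all add: hom_op hom_proj proj_op proj_nonzero)

text \<open>Elimination: if the components of \<open>y\<close> below \<open>k\<close> vanish,
  subtracting a suitable multiple of \<open>v k\<close> also removes component \<open>k\<close>. The
  induction descends from \<open>k = Suc d\<close>, where all components of \<open>y\<close> vanish
  and hence \<open>y = 0\<close>.\<close>

lemma expansion:
  assumes v: "triangular d P v"
  shows "\<exists>m. x = (\<Sum>i=0..d. sc (m i) (v i))"
proof -
  have "\<exists>m. y = (\<Sum>i=k..d. sc (m i) (v i))" if "\<forall>h<k. h \<le> d \<longrightarrow> P h y = 0" "k \<le> Suc d" for k y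
    using that(2,1)
  proof (induction k arbitrary: y rule: inc_induct)
    case base
    then have "y = 0"
      using sum_proj[of y] by simp
    then show ?case by simp
  next
    case (step k)
    then have k: "k \<le> d" by simp
    then obtain c where c: "P k y = sc c (P k (v k))"
      using v proj_rank_one unfolding triangular_def by blast
    have "P h (y - sc c (v k)) = 0" if "h < Suc k" "h \<le> d" for h
    proof -
      have "P h (y - sc c (v k)) = P h y - sc c (P h (v k))"
        using hom_proj[OF that(2)] by (simp add: module_hom.diff module_hom.scale)
      then show ?thesis
        using that c step.prems v k by (cases "h = k") (auto simp: triangular_def)
    qed
    then obtain m where m: "y - sc c (v k) = (\<Sum>i=Suc k..d. sc (m i) (v i))"
      using step.IH by blast
    have "y = sc c (v k) + (\<Sum>i=Suc k..d. sc (m i) (v i))"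
      using m by (simp add: algebra_simps)
    also have "\<dots> = (\<Sum>i=k..d. sc ((m(k := c)) i) (v i))"
      using k by (simp add: sum.atLeast_Suc_atMost)
    finally show ?case by blast
  qed
  from this[of 0 x] show ?thesis by simp
qed

text \<open>Forward substitution: \<open>P j\<close> kills \<open>v i\<close> for
  \<open>i > j\<close>, and the coefficients before \<open>j\<close> are zero by induction, so only
  the \<open>j\<close>-th term survives. With \<open>x = 0\<close> and \<open>k = Suc d\<close> this
  is linear independence; smaller \<open>k\<close> bounds the support of an expansion from
  below.\<close>

lemma coeff_eq_0:
  assumes v: "triangular d P v" and x: "x = (\<Sum>i=0..d. sc (m i) (v i))"
    and P: "\<And>h. h < k \<Longrightarrow> h \<le> d \<Longrightarrow> P h x = 0"
    and j: "j < k" "j \<le> d"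
  shows "m j = 0"
  using j
proof (induction j rule: less_induct)
  case (less j)
  have "0 = P j x" using P less.prems by simp
  also have "\<dots> = (\<Sum>i=0..d. sc (m i) (P j (v i)))"
    using hom_proj[of j] less.prems by (simp add: x module_hom.sum module_hom.scale)
  also have "\<dots> = (\<Sum>i=0..d. if i = j then sc (m j) (P j (v j)) else 0)"
  proof (rule sum.cong)
    fix i assume "i \<in> {0..d}"
    then show "sc (m i) (P j (v i)) = (if i = j then sc (m j) (P j (v j)) else 0)"
      using less v unfolding triangular_def by (cases i j rule: linorder_cases) auto
  qed simp
  finally show ?case
    using v less.prems by (simp add: triangular_def)
qed

text \<open>A triangular family is a basis, which makes the description in \<open>matrix_of\<close>
  definite: existence comes from \<open>expansion\<close>, uniqueness from \<open>coeff_eq_0\<close>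
  applied to the difference of two candidate columns.\<close>

lemma
  assumes v: "triangular d P v"
  shows matrix_of_carrier: "matrix_of d sc v f \<in> carrier_mat (d + 1) (d + 1)"
    and matrix_of_eq:
      "j \<le> d \<Longrightarrow> f (v j) = (\<Sum>i=0..d. sc (matrix_of d sc v f $$ (i, j)) (v i))"
proof -
  let ?R = "\<lambda>M. M \<in> carrier_mat (d + 1) (d + 1) \<and>
    (\<forall>j\<in>{0..d}. f (v j) = (\<Sum>i=0..d. sc (M $$ (i, j)) (v i)))"
  obtain m where m: "\<And>x. x = (\<Sum>i=0..d. sc (m x i) (v i))"
    using expansion[OF v] by metis
  let ?M = "mat (d + 1) (d + 1) (\<lambda>(i, j). m (f (v j)) i)"
  have M: "?R ?M"
  proof (intro conjI ballI)
    fix j assume "j \<in> {0..d}"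
    then have "(\<Sum>i=0..d. sc (?M $$ (i, j)) (v i)) = (\<Sum>i=0..d. sc (m (f (v j)) i) (v i))"
      by (intro sum.cong) auto
    then show "f (v j) = (\<Sum>i=0..d. sc (?M $$ (i, j)) (v i))"
      using m[of "f (v j)"] by simp
  qed simp
  have unique: "N = ?M" if N: "?R N" for N
  proof (rule eq_matI)
    fix i j assume "i < dim_row ?M" "j < dim_col ?M"
    then have ij: "i \<le> d" "j \<le> d" by auto
    have "(\<Sum>i=0..d. sc (N $$ (i, j)) (v i)) = (\<Sum>i=0..d. sc (?M $$ (i, j)) (v i))"
      using bspec[OF conjunct2[OF N], of j] bspec[OF conjunct2[OF M], of j] ij
      by (simp only: atLeastAtMost_iff le0 simp_thms)
    then have "0 = (\<Sum>i=0..d. sc (N $$ (i, j) - ?M $$ (i, j)) (v i))"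
      by (simp add: scale_left_diff_distrib sum_subtractf)
    moreover have "P h 0 = 0" if "h \<le> d" for h
      using module_hom.zero[OF hom_proj[OF that]] .
    ultimately have "N $$ (i, j) - ?M $$ (i, j) = 0"
      using coeff_eq_0[OF v, of 0 "\<lambda>i. N $$ (i, j) - ?M $$ (i, j)" "Suc d" i] ij by simp
    then show "N $$ (i, j) = ?M $$ (i, j)" by simp
  qed (use that in auto)
  have "?R (matrix_of d sc v f)"
    unfolding matrix_of_def by (rule theI[of ?R, OF M]) (rule unique)
  then show "matrix_of d sc v f \<in> carrier_mat (d + 1) (d + 1)"
    and "j \<le> d \<Longrightarrow> f (v j) = (\<Sum>i=0..d. sc (matrix_of d sc v f $$ (i, j)) (v i))"
    by auto
qed

text \<open>A tridiagonal operator raises the top index \<open>n\<close> of a vector by at most one.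
  Splitting \<open>y\<close> into its components, only the term \<open>k = n\<close> can contribute
  at index \<open>Suc n\<close>, and irreducibility keeps it nonzero.\<close>

lemma proj_tridiagonal:
  assumes f: "module_hom sc sc f" "tridiagonal_action d f P"
    and y: "\<And>k. k \<le> d \<Longrightarrow> n < k \<Longrightarrow> P k y = 0" and h: "h \<le> d"
  shows "Suc n < h \<Longrightarrow> P h (f y) = 0"
    and "h = Suc n \<Longrightarrow> P n y \<noteq> 0 \<Longrightarrow> P h (f y) \<noteq> 0"
proof -
  interpret f: module_hom sc sc f by (rule f)
  interpret P: module_hom sc sc "P h" by (rule hom_proj[OF h])
  have "P h (f y) = P h (f (\<Sum>k=0..d. P k y))"
    by (simp add: sum_proj)
  then have sum: "P h (f y) = (\<Sum>k=0..d. P h (f (P k y)))"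
    by (simp add: f.sum P.sum)
  have zero: "P h (f (P k y)) = 0" if "Suc k < h \<or> n < k" "k \<le> d" for k
    using that f(2) y h unfolding tridiagonal_action_def by auto
  show "P h (f y) = 0" if "Suc n < h"
    unfolding sum using that by (intro sum.neutral) (auto intro!: zero)
  show "P h (f y) \<noteq> 0" if n: "h = Suc n" "P n y \<noteq> 0"
  proof -
    have "P h (f y) = (\<Sum>k=0..d. if k = n then P h (f (P n y)) else 0)"
      unfolding sum
    proof (rule sum.cong)
      fix k assume "k \<in> {0..d}"
      then show "P h (f (P k y)) = (if k = n then P h (f (P n y)) else 0)"
        using zero[of k] n by (cases k n rule: linorder_cases) auto
    qed simp
    then show ?thesis
      using n h f(2) by (auto simp: tridiagonal_action_def)
  qed
qed

end

section \<open>Leonard pairs of operators, their split bases and eigenbases\<close>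

locale leonard_pair =
  P: spectral_resolution sc d a \<theta> P + Q: spectral_resolution sc d b \<phi> Q
  for sc :: "'k::field \<Rightarrow> 'v::ab_group_add \<Rightarrow> 'v" and d a \<theta> P b \<phi> Q +
  assumes tri_P: "tridiagonal_action d b P" and tri_Q: "tridiagonal_action d a Q"
begin

lemma swap: "leonard_pair sc d b \<phi> Q a \<theta> P"
  by unfold_locales (rule tri_Q tri_P)+

lemma reverse_left: "leonard_pair sc d a (\<lambda>i. \<theta> (d - i)) (\<lambda>i. P (d - i)) b \<phi> Q"
  using tri_P tri_Q
  by (intro leonard_pair.intro P.reverse Q.spectral_resolution_axioms
      leonard_pair_axioms.intro tridiagonal_action_reverse)

text \<open>This is \<open>reverse_left\<close> conjugated by \<open>swap\<close>. Through these
  relabellings any of the four end vectors can be moved into the range of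
  \<open>Q 0\<close>.\<close>

lemma reverse_right: "leonard_pair sc d a \<theta> P b (\<lambda>i. \<phi> (d - i)) (\<lambda>i. Q (d - i))"
  using leonard_pair.swap[OF leonard_pair.reverse_left[OF swap]] .

lemma reverse_both:
  "leonard_pair sc d a (\<lambda>i. \<theta> (d - i)) (\<lambda>i. P (d - i)) b (\<lambda>i. \<phi> (d - i)) (\<lambda>i. Q (d - i))"
  using leonard_pair.reverse_right[OF reverse_left] .

text \<open>Two one-sided bounds on the support of \<open>a (v j)\<close>. Since \<open>a\<close>
  acts on each \<open>P h\<close> component as a scalar, no index below \<open>j\<close> occurs;
  since \<open>a\<close> is tridiagonal for \<open>Q\<close>, the top \<open>Q\<close> index rises
  by at most one and no index above \<open>Suc j\<close> occurs.\<close>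

lemma split_basis_coeff:
  assumes v: "split_basis d P Q v" and j: "j \<le> d"
    and m: "a (v j) = (\<Sum>i=0..d. sc (m i) (v i))" and i: "i \<le> d" "m i \<noteq> 0"
  shows "i = j \<or> i = Suc j"
proof -
  interpret R: spectral_resolution sc d b "\<lambda>i. \<phi> (d - i)" "\<lambda>i. Q (d - i)"
    by (rule Q.reverse)
  have P: "triangular d P v" and Q: "triangular d (\<lambda>i. Q (d - i)) (\<lambda>i. v (d - i))"
    using v by (auto simp: split_basis_def)
  have "P h (a (v j)) = 0" if "h < j" "h \<le> d" for h
    using that P j by (simp add: P.proj_op triangular_def)
  then have *: "\<not> i < j"
    using P.coeff_eq_0[OF P m] i by blast
  have Qv: "Q k (v j) = 0" if "k \<le> d" "j < k" for k
    using Q[unfolded triangular_def, rule_format, of "d - j"] that j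
    by (metis diff_diff_cancel diff_le_self diff_less_mono2 order.strict_trans2)
  \<comment> \<open>In the reversed order the bound \<open>h < d - Suc j\<close> says that
    \<open>d - h\<close> exceeds \<open>Suc j\<close>.\<close>
  have "Q (d - h) (a (v j)) = 0" if "h < d - Suc j" "h \<le> d" for h
    using that j by (intro Q.proj_tridiagonal(1)[OF P.hom_op tri_Q Qv]) auto
  moreover have "a (v j) = (\<Sum>i=0..d. sc (m (d - i)) (v (d - i)))"
    using m sum.atLeastAtMost_rev[of "\<lambda>i. sc (m i) (v i)" 0 d] by simp
  ultimately have "m (d - (d - i)) = 0" if "d - i < d - Suc j"
    using R.coeff_eq_0[OF Q, of "a (v j)" "\<lambda>i. m (d - i)" "d - Suc j" "d - i"] that by simp
  moreover have "d - i < d - Suc j" if "Suc j < i"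
    using that i by arith
  ultimately have "\<not> Suc j < i"
    using i by auto
  with * show ?thesis by auto
qed

text \<open>The claim for \<open>a\<close> is \<open>split_basis_coeff\<close>. For \<open>b\<close>
  the same lemma is applied to the swapped pair with both orders reversed, and undoing the index
  reversal turns lower into upper.\<close>

lemma bidiagonal_split_basis:
  assumes v: "split_basis d P Q v"
  shows "lower_bidiagonal (matrix_of d sc v a)" and "upper_bidiagonal (matrix_of d sc v b)"
proof -
  have P: "triangular d P v"
    using v by (simp add: split_basis_def)
  let ?A = "matrix_of d sc v a" and ?B = "matrix_of d sc v b"
  show "lower_bidiagonal ?A"
    using P.matrix_of_carrier[OF P, of a] split_basis_coeff[OF v _ P.matrix_of_eq[OF P, of _ a]]
    by (auto simp: lower_bidiagonal_def)
  interpret R: leonard_pair sc d b "\<lambda>i. \<phi> (d - i)" "\<lambda>i. Q (d - i)" a "\<lambda>i. \<theta> (d - i)" "\<lambda>i. P (d - i)"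
    using leonard_pair.swap[OF reverse_both] .
  have "i = j \<or> Suc i = j" if ij: "i \<le> d" "j \<le> d" "?B $$ (i, j) \<noteq> 0" for i j
  proof -
    have "b (v (d - (d - j))) = (\<Sum>i=0..d. sc (?B $$ (d - i, j)) (v (d - i)))"
      using P.matrix_of_eq[OF P ij(2), of b] ij
        sum.atLeastAtMost_rev[of "\<lambda>i. sc (?B $$ (i, j)) (v i)" 0 d] by simp
    from R.split_basis_coeff[OF split_basis_reverse[OF v] _ this, of "d - i"] ij show ?thesis
      by auto
  qed
  then show "upper_bidiagonal ?B"
    using P.matrix_of_carrier[OF P, of b]
    by (auto simp: upper_bidiagonal_def lower_bidiagonal_def less_Suc_eq_le)
qed

text \<open>Each factor \<open>a - c\<close> raises the top \<open>Q\<close> index by exactly one: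
  the scalar part does not reach the new index, and \<open>proj_tridiagonal\<close> controls the
  rest. The shifts \<open>cs\<close> are arbitrary, so powers of \<open>a\<close> and the products
  \<open>\<tau>\<close> and \<open>\<sigma>\<close> are all covered.\<close>

lemma krylov:
  assumes \<eta>: "Q 0 \<eta> = \<eta>" "\<eta> \<noteq> 0" and cs: "length cs \<le> d"
  defines "y \<equiv> foldr (\<lambda>c x. a x - sc c x) cs \<eta>"
  shows "Q (length cs) y \<noteq> 0" and "\<And>h. h \<le> d \<Longrightarrow> length cs < h \<Longrightarrow> Q h y = 0"
proof -
  have "Q (length cs) y \<noteq> 0 \<and> (\<forall>h\<le>d. length cs < h \<longrightarrow> Q h y = 0)"
    using cs unfolding y_def
  proof (induction cs)
    case Nil
    have "Q h \<eta> = 0" if "0 < h" "h \<le> d" for h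
      using Q.proj_proj[of h 0 \<eta>] \<eta> that by simp
    then show ?case
      using \<eta> by simp
  next
    case (Cons c cs)
    let ?y = "foldr (\<lambda>c x. a x - sc c x) cs \<eta>"
    have IH: "Q (length cs) ?y \<noteq> 0" "\<And>h. h \<le> d \<Longrightarrow> length cs < h \<Longrightarrow> Q h ?y = 0"
      using Cons by auto
    have "Q h (a ?y - sc c ?y) = Q h (a ?y)" if "h \<le> d" "length cs < h" for h
      using that IH Q.hom_proj[of h] by (simp add: module_hom.diff module_hom.scale)
    moreover note Q.proj_tridiagonal[OF P.hom_op tri_Q IH(2)] IH(1)
    ultimately show ?case
      using Cons.prems by auto
  qed
  then show "Q (length cs) y \<noteq> 0" and "\<And>h. h \<le> d \<Longrightarrow> length cs < h \<Longrightarrow> Q h y = 0"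
    by auto
qed

text \<open>Since \<open>P h\<close> turns \<open>a\<close> into multiplication by
  \<open>\<theta> h\<close>, a polynomial in \<open>a\<close> is seen by \<open>P h\<close> as its
  value at \<open>\<theta> h\<close>.\<close>

lemma proj_foldr:
  assumes "h \<le> d"
  shows "P h (foldr (\<lambda>c x. a x - sc c x) cs \<eta>) = sc (\<Prod>c\<leftarrow>cs. \<theta> h - c) (P h \<eta>)"
proof (induction cs)
  case (Cons c cs)
  interpret module_hom sc sc "P h" by (rule P.hom_proj[OF assms])
  show ?case
    by (simp add: diff scale P.proj_op assms Cons P.scale_left_diff_distrib left_diff_distrib)
qed simp

lemma triangular_krylov:
  assumes \<eta>: "Q 0 \<eta> = \<eta>" "\<eta> \<noteq> 0" and cs: "\<And>i. i \<le> d \<Longrightarrow> length (cs i) = i"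
  shows "triangular d (\<lambda>i. Q (d - i)) (\<lambda>i. foldr (\<lambda>c x. a x - sc c x) (cs (d - i)) \<eta>)"
  unfolding triangular_def
proof (intro allI impI conjI)
  fix i h assume "i \<le> d"
  show "Q (d - i) (foldr (\<lambda>c x. a x - sc c x) (cs (d - i)) \<eta>) \<noteq> 0"
    using krylov(1)[OF \<eta>, of "cs (d - i)"] cs[of "d - i"] by simp
  assume "h < i"
  then show "Q (d - h) (foldr (\<lambda>c x. a x - sc c x) (cs (d - i)) \<eta>) = 0"
    using krylov(2)[OF \<eta>, of "cs (d - i)"] cs[of "d - i"] \<open>i \<le> d\<close> by simp
qed

text \<open>Since \<open>a\<close> acts on the ranges of the \<open>Q i\<close> as an irreducible tridiagonal matrix, \<open>\<eta>\<close> is a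
  cyclic vector for \<open>a\<close>.\<close>
lemma proj_end_vector_nonzero:
  assumes \<eta>: "Q 0 \<eta> = \<eta>" "\<eta> \<noteq> 0" and i: "i \<le> d"
  shows "P i \<eta> \<noteq> 0"
proof
  assume zero: "P i \<eta> = 0"
  interpret R: spectral_resolution sc d b "\<lambda>i. \<phi> (d - i)" "\<lambda>i. Q (d - i)"
    by (rule Q.reverse)
  interpret Pi: module_hom sc sc "P i" by (rule P.hom_proj[OF i])
  \<comment> \<open>With all shifts \<open>0\<close> these are powers of \<open>a\<close> applied to
    \<open>\<eta>\<close>. They span the space, so \<open>P i \<eta> = 0\<close> would force
    \<open>P i\<close> to vanish everywhere.\<close>
  let ?v = "\<lambda>k. foldr (\<lambda>c x. a x - sc c x) (replicate (d - k) 0) \<eta>"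
  have tri: "triangular d (\<lambda>i. Q (d - i)) ?v"
    by (rule triangular_krylov[OF \<eta>]) simp
  obtain x where x: "P i x \<noteq> 0"
    using P.proj_nonzero[OF i] by blast
  obtain m where "x = (\<Sum>k=0..d. sc (m k) (?v k))"
    using R.expansion[OF tri] by blast
  then have "P i x = (\<Sum>k=0..d. sc (m k) (P i (?v k)))"
    by (simp only: Pi.sum Pi.scale)
  also have "\<dots> = 0"
    using zero by (simp only: proj_foldr[OF i] P.scale_zero_right sum.neutral_const)
  finally show False using x by simp
qed

text \<open>By \<open>proj_foldr\<close>, the \<open>P h\<close> component of the
  \<open>i\<close>-th vector carries the factor
  \<open>\<Prod>c\<leftarrow>cs i. \<theta> h - c\<close>. It is zero for \<open>h < i\<close>
  because \<open>\<theta> h\<close> is among the shifts, and nonzero for \<open>h = i\<close>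
  because the eigenvalues are distinct. Requiring only the set of the shifts leaves the order of the
  factors free.\<close>

lemma split_basis_krylov:
  assumes \<eta>: "Q 0 \<eta> = \<eta>" "\<eta> \<noteq> 0"
    and cs: "\<And>i. i \<le> d \<Longrightarrow> length (cs i) = i" "\<And>i. i \<le> d \<Longrightarrow> set (cs i) = \<theta> ` {..<i}"
  shows "split_basis d P Q (\<lambda>i. foldr (\<lambda>c x. a x - sc c x) (cs i) \<eta>)"
proof -
  have "triangular d P (\<lambda>i. foldr (\<lambda>c x. a x - sc c x) (cs i) \<eta>)"
    unfolding triangular_def
  proof (intro allI impI conjI)
    fix i h assume i: "i \<le> d"
    have "\<theta> i \<noteq> \<theta> h" if "h < i" for h
      using inj_onD[OF P.inj_eigenvalues, of i h] that i by auto
    then have "(\<Prod>c\<leftarrow>cs i. \<theta> i - c) \<noteq> 0"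
      using cs(2)[OF i] by (auto simp: prod_list_zero_iff)
    then show "P i (foldr (\<lambda>c x. a x - sc c x) (cs i) \<eta>) \<noteq> 0"
      using proj_end_vector_nonzero[OF \<eta> i] by (simp add: proj_foldr i)
    assume h: "h < i"
    then have "(\<Prod>c\<leftarrow>cs i. \<theta> h - c) = 0"
      using cs(2)[OF i] by (auto simp: prod_list_zero_iff)
    then show "P h (foldr (\<lambda>c x. a x - sc c x) (cs i) \<eta>) = 0"
      using h i by (simp add: proj_foldr)
  qed
  then show ?thesis
    using triangular_krylov[OF \<eta> cs(1)] by (simp add: split_basis_def)
qed

lemma eigenbasis:
  assumes \<eta>: "Q 0 \<eta> = \<eta>" "\<eta> \<noteq> 0"
  shows "diagonal_mat (matrix_of d sc (\<lambda>i. P i \<eta>) a)"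
    and "irreducible_tridiagonal (matrix_of d sc (\<lambda>i. P i \<eta>) b)"
proof -
  let ?v = "\<lambda>i. P i \<eta>"
  have nz: "P i \<eta> \<noteq> 0" if "i \<le> d" for i
    using proj_end_vector_nonzero[OF \<eta> that] .
  have tri: "triangular d P ?v"
    unfolding triangular_def
  proof (intro allI impI conjI)
    fix i h assume i: "i \<le> d"
    show "P i (P i \<eta>) \<noteq> 0"
      using nz[OF i] P.proj_proj[OF i i, of \<eta>] by simp
    assume "h < i"
    then show "P h (P i \<eta>) = 0"
      using P.proj_proj[of h i \<eta>] i by simp
  qed
  \<comment> \<open>Applying \<open>P i\<close> to the expansion of \<open>f (?v j)\<close> isolates
    the matrix entry at \<open>(i, j)\<close>.\<close>
  have coeff: "P i (f (?v j)) = sc (matrix_of d sc ?v f $$ (i, j)) (?v i)"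
    if ij: "i \<le> d" "j \<le> d" for f i j
  proof -
    interpret Pi: module_hom sc sc "P i" by (rule P.hom_proj[OF ij(1)])
    have "P i (f (?v j)) = (\<Sum>k=0..d. sc (matrix_of d sc ?v f $$ (k, j)) (P i (P k \<eta>)))"
      by (subst P.matrix_of_eq[OF tri ij(2)]) (simp only: Pi.sum Pi.scale)
    also have "\<dots> = (\<Sum>k=0..d. if k = i then sc (matrix_of d sc ?v f $$ (i, j)) (?v i) else 0)"
      by (intro sum.cong) (auto simp: P.proj_proj ij)
    finally show ?thesis using ij by simp
  qed
  let ?A = "matrix_of d sc ?v a" and ?B = "matrix_of d sc ?v b"
  have "?A $$ (i, j) = 0" if "i \<le> d" "j \<le> d" "i \<noteq> j" for i j
    using coeff[OF that(1,2), of a] that nz by (simp add: P.proj_op P.proj_proj)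
  then show "diagonal_mat ?A"
    using P.matrix_of_carrier[OF tri, of a] by (auto simp: diagonal_mat_def)
  have "?B $$ (i, j) = 0" if "i \<le> d" "j \<le> d" "\<bar>int i - int j\<bar> > 1" for i j
  proof -
    have "Suc i < j \<or> Suc j < i" using that by auto
    then show ?thesis
      using coeff[OF that(1,2), of b] that nz tri_P by (auto simp: tridiagonal_action_def)
  qed
  moreover have "?B $$ (i, j) \<noteq> 0" if "i \<le> d" "j \<le> d" "\<bar>int i - int j\<bar> = 1" for i j
  proof -
    have "i = Suc j \<or> j = Suc i" using that by auto
    then have "P i (b (?v j)) \<noteq> 0"
      using that nz tri_P by (auto simp: tridiagonal_action_def)
    then show ?thesis
      using coeff[OF that(1,2), of b] by auto
  qed
  ultimately show "irreducible_tridiagonal ?B"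
    using P.matrix_of_carrier[OF tri, of b]
    by (auto simp: irreducible_tridiagonal_def tridiagonal_def)
qed

text \<open>The reversed family is a split basis for the swapped, doubly reversed pair, in which
  \<open>b\<close> takes the place of \<open>a\<close>.\<close>

lemma bidiagonal_reverse:
  assumes "split_basis d P Q v"
  shows "upper_bidiagonal (matrix_of d sc (\<lambda>i. v (d - i)) a)"
    and "lower_bidiagonal (matrix_of d sc (\<lambda>i. v (d - i)) b)"
  using leonard_pair.bidiagonal_split_basis[OF leonard_pair.swap[OF reverse_both]
      split_basis_reverse[OF assms]] by auto

lemma split_basis_tau:
  assumes "Q 0 \<eta> = \<eta>" "\<eta> \<noteq> 0"
  shows "split_basis d P Q (\<lambda>i. foldr (\<lambda>c x. a x - sc c x) (map \<theta> [0..<i]) \<eta>)"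
  by (rule split_basis_krylov[OF assms]) (auto simp: atLeast0LessThan)

text \<open>The shifts of \<open>\<sigma>\<close> are the first \<open>i\<close> eigenvalues in the
  reversed order, listed backwards.\<close>

lemma split_basis_sigma:
  assumes "Q 0 \<eta> = \<eta>" "\<eta> \<noteq> 0"
  shows "split_basis d (\<lambda>i. P (d - i)) Q
    (\<lambda>i. foldr (\<lambda>c x. a x - sc c x) (map \<theta> [d - i + 1..<d + 1]) \<eta>)"
proof (rule leonard_pair.split_basis_krylov[OF reverse_left assms])
  fix i assume i: "i \<le> d"
  have "h \<in> (\<lambda>h. d - h) ` {..<i}" if "h \<in> {d - i + 1..<d + 1}" for h
    using that i by (intro image_eqI[of _ _ "d - h"]) auto
  then have "{d - i + 1..<d + 1} = (\<lambda>h. d - h) ` {..<i}"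
    using i by auto
  then show "set (map \<theta> [d - i + 1..<d + 1]) = (\<lambda>h. \<theta> (d - h)) ` {..<i}"
    by (simp only: set_map set_upt image_image)
qed auto

end

section \<open>Matrix units and the irreducible module\<close>

lemma matrix_units:
  fixes scale :: "'k::field \<Rightarrow> 'a::ring_1 \<Rightarrow> 'a"
  assumes "full_matrix_algebra d scale"
  obtains e :: "nat \<Rightarrow> nat \<Rightarrow> 'a" and c :: "'a \<Rightarrow> nat \<Rightarrow> nat \<Rightarrow> 'k" where
    "\<And>i j k l. i \<le> d \<Longrightarrow> j \<le> d \<Longrightarrow> k \<le> d \<Longrightarrow> l \<le> d \<Longrightarrow>
       e i j * e k l = (if j = k then e i l else 0)"
    "\<And>X. X = (\<Sum>i=0..d. \<Sum>j=0..d. scale (c X i j) (e i j))"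
    "1 = (\<Sum>i=0..d. e i i)"
proof -
  from assms obtain \<phi> :: "'a \<Rightarrow> 'k mat" where
    bij: "bij_betw \<phi> UNIV (carrier_mat (d + 1) (d + 1))" and
    one: "\<phi> 1 = 1\<^sub>m (d + 1)" and
    add: "\<And>X Y. \<phi> (X + Y) = \<phi> X + \<phi> Y" and
    mult: "\<And>X Y. \<phi> (X * Y) = \<phi> X * \<phi> Y" and
    smult: "\<And>c X. \<phi> (scale c X) = c \<cdot>\<^sub>m \<phi> X"
    and alg: "vector_space scale"
    unfolding field_algebra_def full_matrix_algebra_def by blast
  have dim: "dim_row (\<phi> X) = d + 1" "dim_col (\<phi> X) = d + 1" for X
    using bij_betwE[OF bij] by auto
  have eqI: "X = Y" if "\<And>p q. p \<le> d \<Longrightarrow> q \<le> d \<Longrightarrow> \<phi> X $$ (p, q) = \<phi> Y $$ (p, q)" for X Y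
  proof -
    have "\<phi> X = \<phi> Y"
      by (rule eq_matI) (use that dim in auto)
    then show ?thesis
      using bij by (auto simp: bij_betw_def inj_on_def)
  qed
  interpret vector_space scale by (rule alg)
  have "\<phi> 0 = 0 \<cdot>\<^sub>m \<phi> 0"
    using smult[of 0 0] by (simp only: scale_zero_right)
  then have zero: "\<phi> 0 $$ (p, q) = 0" if "p \<le> d" "q \<le> d" for p q
    using that dim by (metis index_smult_mat(1) less_Suc_eq_le mult_zero_left Suc_eq_plus1)
  have sum: "\<phi> (\<Sum>i\<in>I. f i) $$ (p, q) = (\<Sum>i\<in>I. \<phi> (f i) $$ (p, q))"
    if "p \<le> d" "q \<le> d" for p q and f :: "nat \<Rightarrow> 'a" and I
    by (induction I rule: infinite_finite_induct) (use that dim in \<open>auto simp: zero add\<close>)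
  define unit :: "nat \<Rightarrow> nat \<Rightarrow> 'k mat" where
    "unit i j = mat (d + 1) (d + 1) (\<lambda>(p, q). if p = i \<and> q = j then 1 else 0)" for i j
  \<comment> \<open>The standard matrix units are pulled back along the isomorphism; the module
    arguments below use only their relations.\<close>
  define e where "e i j = inv_into UNIV \<phi> (unit i j)" for i j
  have e: "\<phi> (e i j) = unit i j" for i j
    unfolding e_def using bij
    by (intro f_inv_into_f) (auto simp: bij_betw_def unit_def)
  show ?thesis
  proof (rule that)
    show "e i j * e k l = (if j = k then e i l else 0)"
      if ij: "i \<le> d" "j \<le> d" "k \<le> d" "l \<le> d" for i j k l
    proof (rule eqI)
      fix p q assume pq: "p \<le> d" "q \<le> d"
      have "\<phi> (e i j * e k l) $$ (p, q) =
          (\<Sum>r=0..<d+1. (if p = i \<and> r = j then 1 else 0) * (if r = k \<and> q = l then 1 else 0))"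
        using pq by (simp add: mult e unit_def scalar_prod_def)
      also have "\<dots> = (\<Sum>r=0..<d+1. if r = j then (if p = i \<and> j = k \<and> q = l then 1 else 0) else 0)"
        by (rule sum.cong) auto
      also have "\<dots> = \<phi> (if j = k then e i l else 0) $$ (p, q)"
        using pq ij by (auto simp: e unit_def zero)
      finally show "\<phi> (e i j * e k l) $$ (p, q) = \<phi> (if j = k then e i l else 0) $$ (p, q)" .
    qed
    show "X = (\<Sum>i=0..d. \<Sum>j=0..d. scale (\<phi> X $$ (i, j)) (e i j))" for X
    proof (rule eqI)
      fix p q assume pq: "p \<le> d" "q \<le> d"
      have "\<phi> (\<Sum>i=0..d. \<Sum>j=0..d. scale (\<phi> X $$ (i, j)) (e i j)) $$ (p, q) =
          (\<Sum>i=0..d. \<Sum>j=0..d. \<phi> X $$ (i, j) * (if p = i \<and> q = j then 1 else 0))"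
        using pq by (simp add: sum smult e unit_def)
      also have "\<dots> =
          (\<Sum>i=0..d. \<Sum>j=0..d. if j = q then (if i = p then \<phi> X $$ (p, q) else 0) else 0)"
        by (intro sum.cong) auto
      also have "\<dots> = \<phi> X $$ (p, q)"
        using pq by simp
      finally show "\<phi> X $$ (p, q) =
          \<phi> (\<Sum>i=0..d. \<Sum>j=0..d. scale (\<phi> X $$ (i, j)) (e i j)) $$ (p, q)" ..
    qed
    show "1 = (\<Sum>i=0..d. e i i)"
    proof (rule eqI)
      fix p q assume pq: "p \<le> d" "q \<le> d"
      have "\<phi> (\<Sum>i=0..d. e i i) $$ (p, q) = (\<Sum>i=0..d. if i = p then (if p = q then 1 else 0) else 0)"
        using pq by (simp add: sum e unit_def) (auto intro!: sum.neutral)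
      also have "\<dots> = \<phi> 1 $$ (p, q)"
        using pq by (simp add: one)
      finally show "\<phi> 1 $$ (p, q) = \<phi> (\<Sum>i=0..d. e i i) $$ (p, q)" ..
    qed
  qed
qed

locale irreducible_matrix_module =
  fixes d :: nat
    and scale :: "'k::field \<Rightarrow> 'a::ring_1 \<Rightarrow> 'a"
    and act :: "'a \<Rightarrow> 'v::ab_group_add \<Rightarrow> 'v"
  assumes full: "full_matrix_algebra d scale"
    and irreducible: "irreducible_left_module act"
begin

abbreviation sc :: "'k \<Rightarrow> 'v \<Rightarrow> 'v" where
  "sc c \<equiv> act (scale c 1)"

sublocale alg: vector_space scale
  using full by (simp add: full_matrix_algebra_def field_algebra_def)

lemma scale_mult: "scale c X * Y = scale c (X * Y)" "X * scale c Y = scale c (X * Y)"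
  using full by (simp_all add: full_matrix_algebra_def field_algebra_def)

lemma act_simps:
  "act X (u + v) = act X u + act X v"
  "act (X + Y) v = act X v + act Y v"
  "act (X * Y) v = act X (act Y v)"
  "act 1 v = v"
  using irreducible by (simp_all add: irreducible_left_module_def left_module_def)

lemma act_scale: "act (scale c X) v = sc c (act X v)"
  by (simp add: scale_mult flip: act_simps(3))

lemma act_sc: "act X (sc c v) = sc c (act X v)"
  by (simp add: scale_mult flip: act_simps(3))

sublocale vector_space sc
proof
  show "sc (c + c') v = sc c v + sc c' v" for c c' v
    by (simp add: alg.scale_left_distrib act_simps)
  show "sc c (sc c' v) = sc (c * c') v" for c c' v
    by (simp add: scale_mult mult.commute flip: act_simps(3))
qed (simp_all add: act_simps)

lemma hom_act: "module_hom sc sc (act X)"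
  by unfold_locales (simp_all add: act_simps act_sc)

lemma act_0_left: "act 0 v = 0"
  using act_simps(2)[of 0 0 v] by simp

lemma act_minus_left: "act (X - Y) v = act X v - act Y v"
  using act_simps(2)[of "X - Y" Y v] by (simp add: algebra_simps)

lemma act_sum_left: "act (\<Sum>i\<in>I. f i) v = (\<Sum>i\<in>I. act (f i) v)"
  by (induction I rule: infinite_finite_induct) (simp_all add: act_0_left act_simps)

lemmas act_0_right = module_hom.zero[OF hom_act]
  and act_sum_right = module_hom.sum[OF hom_act]

text \<open>With matrix units \<open>e i j\<close>, some \<open>u = e 0 k v\<close> is nonzero, and the vectors \<open>e i 0 u\<close>
  span the module because \<open>X (e 0 0) = (\<Sum>i. X\<^sub>i\<^sub>0 e i 0)\<close>.\<close>
lemma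
  shows spanning: "\<exists>w. \<forall>v. \<exists>c. v = (\<Sum>i=0..d. sc (c i) (w i))"
    and faithful: "X \<noteq> 0 \<Longrightarrow> \<exists>v. act X v \<noteq> 0"
proof -
  obtain e c where
    ee: "\<And>i j k l. i \<le> d \<Longrightarrow> j \<le> d \<Longrightarrow> k \<le> d \<Longrightarrow> l \<le> d \<Longrightarrow>
       e i j * e k l = (if j = k then e i l else 0)" and
    coord: "\<And>X. X = (\<Sum>i=0..d. \<Sum>j=0..d. scale (c X i j) (e i j))" and
    one: "1 = (\<Sum>i=0..d. e i i)"
    using matrix_units[OF full] by blast
  obtain v0 :: 'v where v0: "v0 \<noteq> 0"
    using irreducible by (auto simp: irreducible_left_module_def)
  \<comment> \<open>Writing \<open>1\<close> as the sum of the products \<open>e k 0 * e 0 k\<close>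
    shows that \<open>e 0 k\<close> cannot kill \<open>v0\<close> for every
    \<open>k\<close>.\<close>
  have "v0 = (\<Sum>k=0..d. act (e k 0) (act (e 0 k) v0))"
  proof -
    have "v0 = act 1 v0" by (simp add: act_simps)
    also have "\<dots> = (\<Sum>k=0..d. act (e k k) v0)"
      by (subst one) (simp add: act_sum_left)
    also have "\<dots> = (\<Sum>k=0..d. act (e k 0) (act (e 0 k) v0))"
      by (intro sum.cong) (simp_all add: ee flip: act_simps(3))
    finally show ?thesis .
  qed
  then obtain k where k: "k \<le> d" "act (e 0 k) v0 \<noteq> 0"
    using v0 by (metis (no_types, lifting) act_0_right atLeastAtMost_iff sum.neutral)
  define u where "u = act (e 0 k) v0"
  have u: "u \<noteq> 0" "act (e 0 0) u = u"
    using k by (simp_all add: u_def ee flip: act_simps(3))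
  have column: "X * e q 0 = (\<Sum>i=0..d. scale (c X i q) (e i 0))" if "q \<le> d" for X q
  proof -
    have "X * e q 0 = (\<Sum>i=0..d. \<Sum>j=0..d. scale (c X i j) (e i j * e q 0))"
      by (subst coord[of X]) (simp add: sum_distrib_right scale_mult)
    also have "\<dots> = (\<Sum>i=0..d. \<Sum>j=0..d. if j = q then scale (c X i q) (e i 0) else 0)"
      using that by (intro sum.cong) (auto simp: ee)
    finally show ?thesis using that by simp
  qed
  have "left_submodule act (range (\<lambda>X. act X u))"
    unfolding left_submodule_def
  proof (intro conjI ballI allI)
    show "0 \<in> range (\<lambda>X. act X u)"
      by (metis act_0_left rangeI)
    show "x + y \<in> range (\<lambda>X. act X u)"
      if "x \<in> range (\<lambda>X. act X u)" "y \<in> range (\<lambda>X. act X u)" for x y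
      using that by (auto simp flip: act_simps(2))
    show "act Y x \<in> range (\<lambda>X. act X u)" if "x \<in> range (\<lambda>X. act X u)" for x Y
      using that by (auto simp flip: act_simps(3))
  qed
  moreover have "range (\<lambda>X. act X u) \<noteq> {0}"
    using u by (metis rangeI singletonD)
  ultimately have range: "range (\<lambda>X. act X u) = UNIV"
    using irreducible by (auto simp: irreducible_left_module_def)
  have "\<exists>m. v = (\<Sum>i=0..d. sc (m i) (act (e i 0) u))" for v
  proof -
    obtain X where "v = act X u" using range by blast
    then have "v = act (X * e 0 0) u" by (simp add: act_simps u)
    then have "v = (\<Sum>i=0..d. sc (c X i 0) (act (e i 0) u))"
      by (simp add: column act_sum_left act_scale[of _ "e _ _"])
    then show ?thesis by (rule exI[of _ "\<lambda>i. c X i 0"])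
  qed
  then show "\<exists>w. \<forall>v. \<exists>c. v = (\<Sum>i=0..d. sc (c i) (w i))"
    by (intro exI[of _ "\<lambda>i. act (e i 0) u"] allI)
  assume "X \<noteq> 0"
  have "\<exists>p\<le>d. \<exists>q\<le>d. c X p q \<noteq> 0"
  proof (rule ccontr)
    assume "\<not> ?thesis"
    then have "X = 0"
      by (subst coord) simp
    with \<open>X \<noteq> 0\<close> show False by simp
  qed
  then obtain p q where pq: "p \<le> d" "q \<le> d" "c X p q \<noteq> 0" by blast
  \<comment> \<open>Sandwiching \<open>X\<close> between matrix units isolates a nonzero entry,
    which then acts on \<open>u\<close> as a nonzero scalar.\<close>
  have "e 0 p * (X * e q 0) = (\<Sum>i=0..d. if i = p then scale (c X p q) (e 0 0) else 0)"
    unfolding column[OF pq(2)] sum_distrib_left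
    using pq by (intro sum.cong) (auto simp: scale_mult ee)
  then have eXe: "e 0 p * (X * e q 0) = scale (c X p q) (e 0 0)"
    using pq by simp
  have "act (e 0 p) (act X (act (e q 0) u)) = act (e 0 p * (X * e q 0)) u"
    by (simp add: act_simps)
  also have "\<dots> = sc (c X p q) u"
    by (simp only: eXe act_scale[of _ "e 0 0"] u)
  also have "\<dots> \<noteq> 0"
    using pq u by simp
  finally show "\<exists>v. act X v \<noteq> 0"
    by (metis act_0_right)
qed

lemma card_independent_le:
  assumes "independent S"
  shows "finite S \<and> card S \<le> d + 1"
proof -
  obtain w where w: "\<And>v. \<exists>c. v = (\<Sum>i=0..d. sc (c i) (w i))"
    using spanning by blast
  have "v \<in> span (w ` {0..d})" for v
  proof -
    obtain c where "v = (\<Sum>i=0..d. sc (c i) (w i))"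
      using w by blast
    moreover have "(\<Sum>i=0..d. sc (c i) (w i)) \<in> span (w ` {0..d})"
      by (rule span_sum, rule span_scale, rule span_base) simp
    ultimately show ?thesis by simp
  qed
  then have "finite S \<and> card S \<le> card (w ` {0..d})"
    using assms by (intro independent_span_bound) auto
  then show ?thesis
    using card_image_le[of "{0..d}" w] by simp
qed

section \<open>Polynomials in an algebra element and the minimal polynomial\<close>

lemma poly_eval_upto:
  "degree p \<le> n \<Longrightarrow> poly_eval scale p X = (\<Sum>i\<le>n. scale (coeff p i) (X ^ i))"
  unfolding poly_eval_def by (intro sum.mono_neutral_left) (auto simp: coeff_eq_0)

lemma poly_eval_add: "poly_eval scale (p + q) X = poly_eval scale p X + poly_eval scale q X"
proof -
  let ?n = "max (degree p) (degree q)"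
  show ?thesis
    using degree_add_le_max[of p q]
    by (simp add: poly_eval_upto[of _ ?n] alg.scale_left_distrib sum.distrib)
qed

lemma poly_eval_smult: "poly_eval scale (Polynomial.smult c p) X = scale c (poly_eval scale p X)"
  by (simp add: poly_eval_upto[of _ "degree p"] alg.scale_sum_right)

lemma poly_eval_diff: "poly_eval scale (p - q) X = poly_eval scale p X - poly_eval scale q X"
  using poly_eval_add[of p "- q" X] poly_eval_smult[of "- 1" q X] by simp

lemma poly_eval_0: "poly_eval scale 0 X = 0"
  by (simp add: poly_eval_def)

lemma poly_eval_pCons: "poly_eval scale (pCons c p) X = scale c 1 + X * poly_eval scale p X"
proof -
  have "poly_eval scale (pCons c p) X = (\<Sum>i\<le>Suc (degree p). scale (coeff (pCons c p) i) (X ^ i))"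
    by (rule poly_eval_upto) (simp add: degree_pCons_le)
  also have "\<dots> = scale c 1 + X * poly_eval scale p X"
    by (subst sum.atMost_Suc_shift) (simp add: poly_eval_def sum_distrib_left scale_mult)
  finally show ?thesis .
qed

lemma poly_eval_sum: "poly_eval scale (\<Sum>i\<in>I. f i) X = (\<Sum>i\<in>I. poly_eval scale (f i) X)"
  by (induction I rule: infinite_finite_induct) (simp_all add: poly_eval_0 poly_eval_add)

lemma poly_eval_monom: "poly_eval scale (monom c n) X = scale c (X ^ n)"
  by (subst poly_eval_upto[of _ n]) (simp_all add: degree_monom_le if_distrib[of "\<lambda>c. scale c _"] cong: if_cong)

lemma poly_eval_linear_factor:
  "poly_eval scale ([:- \<xi>, 1:] * q) X = (X - scale \<xi> 1) * poly_eval scale q X"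
  by (simp add: mult_pCons_left poly_eval_diff poly_eval_add poly_eval_smult poly_eval_pCons scale_mult algebra_simps)

lemma act_poly_eval:
  assumes "act X v = sc \<xi> v"
  shows "act (poly_eval scale p X) v = sc (poly p \<xi>) v"
proof (induction p)
  case (pCons c p)
  have "act X (sc (poly p \<xi>) v) = sc (poly p \<xi>) (sc \<xi> v)"
    by (simp only: act_sc[of X] assms)
  then show ?case
    using pCons by (simp add: poly_eval_pCons act_simps scale_left_distrib mult.commute)
qed (simp add: poly_eval_0 act_0_left)

text \<open>The matrix units span the algebra, so more powers of \<open>X\<close> than there are
  units must be linearly dependent.\<close>

lemma annihilating_polynomial: "\<exists>q. q \<noteq> 0 \<and> poly_eval scale q X = 0"
proof -
  obtain e :: "nat \<Rightarrow> nat \<Rightarrow> 'a" and c :: "'a \<Rightarrow> nat \<Rightarrow> nat \<Rightarrow> 'k"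
    where coord: "\<And>X. X = (\<Sum>i=0..d. \<Sum>j=0..d. scale (c X i j) (e i j))"
    by (rule matrix_units[OF full]) (rule that)
  let ?B = "(\<lambda>(i, j). e i j) ` ({0..d} \<times> {0..d})"
  have span: "X \<in> alg.span ?B" for X
    by (subst coord, rule alg.span_sum, rule alg.span_sum, rule alg.span_scale,
        rule alg.span_base) auto
  let ?n = "card ?B"
  show ?thesis
  \<comment> \<open>Linear dependence is a property of sets and does not see repeated powers. A
    coincidence of two powers is therefore treated separately, by a difference of monomials.\<close>
  proof (cases "inj_on (\<lambda>i. X ^ i) {..?n}")
    case True
    let ?S = "(\<lambda>i. X ^ i) ` {..?n}"
    have "card ?S = Suc ?n"
      using True by (simp add: card_image)
    then have "alg.dependent ?S"
      using alg.independent_span_bound[of ?B ?S] span by auto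
    then obtain m where m: "\<exists>v\<in>?S. m v \<noteq> 0" "(\<Sum>v\<in>?S. scale (m v) v) = 0"
      by (auto simp: alg.dependent_finite)
    define q where "q = (\<Sum>i\<le>?n. monom (m (X ^ i)) i)"
    obtain i where "i \<le> ?n" "m (X ^ i) \<noteq> 0"
      using m(1) by auto
    then have "coeff q i \<noteq> 0"
      by (simp add: q_def coeff_sum)
    then have "q \<noteq> 0" by auto
    moreover have "poly_eval scale q X = 0"
      using m(2) True by (simp add: q_def poly_eval_sum poly_eval_monom sum.reindex)
    ultimately show ?thesis by blast
  next
    case False
    then obtain i j where ij: "X ^ i = X ^ j" "i \<noteq> j"
      by (auto simp: inj_on_def)
    let ?q = "monom 1 i - monom (1::'k) j"
    have "coeff ?q i \<noteq> 0"
      using ij by simp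
    then have "?q \<noteq> 0" by (metis coeff_0)
    moreover have "poly_eval scale ?q X = 0"
      using ij by (simp add: poly_eval_diff poly_eval_monom)
    ultimately show ?thesis by blast
  qed
qed

text \<open>Existence: scale an annihilating polynomial of least degree to be monic. Uniqueness: two
  such polynomials have the same degree, and a nonzero difference would annihilate \<open>X\<close>
  in smaller degree because the leading terms cancel.\<close>

lemma
  shows monic_min_poly: "lead_coeff (min_poly scale X) = 1"
    and poly_eval_min_poly: "poly_eval scale (min_poly scale X) X = 0"
    and degree_min_poly_le:
      "q \<noteq> 0 \<Longrightarrow> poly_eval scale q X = 0 \<Longrightarrow> degree (min_poly scale X) \<le> degree q"
proof -
  let ?M = "\<lambda>p. lead_coeff p = 1 \<and> poly_eval scale p X = 0 \<and>
    (\<forall>q. q \<noteq> 0 \<and> poly_eval scale q X = 0 \<longrightarrow> degree p \<le> degree q)"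
  obtain r where r: "r \<noteq> 0" "poly_eval scale r X = 0"
    and r_min: "\<And>q. q \<noteq> 0 \<Longrightarrow> poly_eval scale q X = 0 \<Longrightarrow> degree r \<le> degree q"
    using exists_least_iff[of "\<lambda>n. \<exists>q. q \<noteq> 0 \<and> poly_eval scale q X = 0 \<and> degree q = n"]
      annihilating_polynomial[of X] by (metis not_le)
  have "?M (Polynomial.smult (1 / lead_coeff r) r)"
    using r r_min by (simp add: poly_eval_smult)
  then obtain p where p: "?M p" by blast
  have "p' = p" if p': "?M p'" for p'
  proof (rule ccontr)
    assume ne: "p' \<noteq> p"
    have nz: "p \<noteq> 0" "p' \<noteq> 0"
      using p p' by auto
    then have deg: "degree p' = degree p"
      using p p' by (simp add: dual_order.antisym)
    have "poly_eval scale (p' - p) X = 0"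
      using p p' by (simp add: poly_eval_diff)
    then have "degree p \<le> degree (p' - p)"
      using p ne by simp
    moreover have "degree (p' - p) \<le> degree p"
      using deg degree_diff_le_max[of p' p] by simp
    ultimately have n: "degree (p' - p) = degree p"
      by simp
    have "lead_coeff (p' - p) = lead_coeff p' - lead_coeff p"
      by (simp only: n deg coeff_diff)
    then have "lead_coeff (p' - p) = 0"
      using p p' by simp
    then show False using ne by (simp only: leading_coeff_0_iff right_minus_eq)
  qed
  with p have "?M (min_poly scale X)"
    unfolding min_poly_def by (rule theI)
  then show "lead_coeff (min_poly scale X) = 1" "poly_eval scale (min_poly scale X) X = 0"
    "q \<noteq> 0 \<Longrightarrow> poly_eval scale q X = 0 \<Longrightarrow> degree (min_poly scale X) \<le> degree q"
    by blast+
qed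

section \<open>Eigenvectors and primitive idempotents\<close>

lemma eigenvector_exists:
  assumes "\<xi> \<in> eigenvalues scale X"
  shows "\<exists>v. v \<noteq> 0 \<and> act X v = sc \<xi> v"
proof -
  have "poly (min_poly scale X) \<xi> = 0"
    using assms by (simp add: eigenvalues_def)
  then obtain q where q: "min_poly scale X = [:- \<xi>, 1:] * q"
    by (auto simp: poly_eq_0_iff_dvd)
  \<comment> \<open>The cofactor \<open>q\<close> has smaller degree than the minimal polynomial, so
    its value at \<open>X\<close> is nonzero. By faithfulness it sends some \<open>v\<close> to a
    nonzero vector, and that image is the eigenvector.\<close>
  have "q \<noteq> 0"
    using q monic_min_poly[of X] by auto
  then have "degree q < degree (min_poly scale X)"
    unfolding q by (subst degree_mult_eq) auto
  then have "poly_eval scale q X \<noteq> 0"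
    using degree_min_poly_le[of q X] \<open>q \<noteq> 0\<close> by auto
  then obtain v where v: "act (poly_eval scale q X) v \<noteq> 0"
    using faithful by blast
  have "(X - scale \<xi> 1) * poly_eval scale q X = 0"
    using poly_eval_min_poly[of X] by (simp only: q poly_eval_linear_factor)
  then have "act (X - scale \<xi> 1) (act (poly_eval scale q X) v) = 0"
    by (simp only: act_0_left flip: act_simps(3))
  then show ?thesis
    using v by (auto simp: act_minus_left)
qed

text \<open>On an eigenvector for \<open>\<zeta>\<close> a polynomial in \<open>X\<close> acts as
  its value at \<open>\<zeta>\<close>. The polynomial here is the Lagrange interpolation polynomial
  that is \<open>1\<close> at \<open>\<xi>\<close> and \<open>0\<close> at the other
  eigenvalues.\<close>

lemma act_primitive_idempotent:
  assumes fin: "finite (eigenvalues scale X)"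
    and "\<xi> \<in> eigenvalues scale X" "\<zeta> \<in> eigenvalues scale X" and v: "act X v = sc \<zeta> v"
  shows "act (primitive_idempotent scale X \<xi>) v = (if \<xi> = \<zeta> then v else 0)"
proof -
  let ?p = "\<Prod>\<zeta>\<in>eigenvalues scale X - {\<xi>}. Polynomial.smult (1 / (\<xi> - \<zeta>)) [:- \<zeta>, 1:]"
  have "poly ?p \<zeta> = (\<Prod>x\<in>eigenvalues scale X - {\<xi>}. (\<zeta> - x) / (\<xi> - x))"
    by (simp add: poly_prod diff_divide_distrib)
  also have "\<dots> = (if \<xi> = \<zeta> then 1 else 0)"
    using assms by (auto intro!: prod.neutral prod_zero)
  finally have "poly ?p \<zeta> = (if \<xi> = \<zeta> then 1 else 0)" .
  then show ?thesis
    unfolding primitive_idempotent_def act_poly_eval[OF v] by (simp add: act_0_left act_simps)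
qed

text \<open>The \<open>d + 1\<close> eigenvectors are independent in a space spanned by \<open>d + 1\<close> vectors, hence a
  basis. So the Cayley-Hamilton theorem is not needed to see that \<open>X\<close> is diagonalizable.\<close>
lemma spectral_resolution_primitive_idempotents:
  assumes mf: "multiplicity_free d scale X" and ord: "idempotent_ordering d scale X E"
  shows "spectral_resolution sc d (act X) (\<lambda>h. associated_eigenvalue scale X (E h)) (\<lambda>h. act (E h))"
proof -
  let ?S = "eigenvalues scale X" and ?e = "primitive_idempotent scale X"
  have card: "card ?S = d + 1"
    using mf by (simp add: multiplicity_free_def)
  then have fin: "finite ?S"
    by (metis card.infinite Suc_eq_plus1 nat.distinct(1))
  obtain u where u: "\<And>\<xi>. \<xi> \<in> ?S \<Longrightarrow> u \<xi> \<noteq> 0" "\<And>\<xi>. \<xi> \<in> ?S \<Longrightarrow> act X (u \<xi>) = sc \<xi> (u \<xi>)"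
    using eigenvector_exists[of _ X] by metis
  have eu: "act (?e \<xi>) (u \<zeta>) = (if \<xi> = \<zeta> then u \<zeta> else 0)" if "\<xi> \<in> ?S" "\<zeta> \<in> ?S" for \<xi> \<zeta>
    using act_primitive_idempotent[OF fin that u(2)[OF that(2)]] .
  have inj_u: "inj_on u ?S"
    by (rule inj_onI) (metis eu u(1))
  \<comment> \<open>Distinct eigenvalues have distinct idempotents, which makes the description in
    \<open>associated_eigenvalue\<close> definite.\<close>
  have inj_e: "inj_on ?e ?S"
    by (rule inj_onI) (metis eu u(1))
  have e_sum: "act (?e \<xi>) (\<Sum>\<zeta>\<in>?S. sc (c \<zeta>) (u \<zeta>)) = sc (c \<xi>) (u \<xi>)" if "\<xi> \<in> ?S" for c \<xi>
  proof -
    have "act (?e \<xi>) (\<Sum>\<zeta>\<in>?S. sc (c \<zeta>) (u \<zeta>)) = (\<Sum>\<zeta>\<in>?S. if \<zeta> = \<xi> then sc (c \<xi>) (u \<xi>) else 0)"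
      unfolding act_sum_right using that by (intro sum.cong) (auto simp: act_sc[of "?e \<xi>"] eu)
    then show ?thesis using that fin by simp
  qed
  have indep: "independent (u ` ?S)"
  proof
    assume "dependent (u ` ?S)"
    then obtain c where c: "\<exists>v\<in>u ` ?S. c v \<noteq> 0" "(\<Sum>v\<in>u ` ?S. sc (c v) v) = 0"
      using fin by (auto simp: dependent_finite)
    obtain \<xi> where \<xi>: "\<xi> \<in> ?S" "c (u \<xi>) \<noteq> 0"
      using c(1) by blast
    have "(\<Sum>\<zeta>\<in>?S. sc (c (u \<zeta>)) (u \<zeta>)) = 0"
      using c(2) inj_u by (simp add: sum.reindex)
    then have "sc (c (u \<xi>)) (u \<xi>) = 0"
      using e_sum[OF \<xi>(1), of "\<lambda>\<zeta>. c (u \<zeta>)"] by (simp add: act_0_right)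
    then show False
      using \<xi> u by simp
  qed
  have expand: "\<exists>c. v = (\<Sum>\<zeta>\<in>?S. sc (c \<zeta>) (u \<zeta>))" for v
  proof -
    have "v \<in> span (u ` ?S)"
    proof (rule ccontr)
      assume v: "v \<notin> span (u ` ?S)"
      then have "independent (insert v (u ` ?S))"
        using indep by (simp add: independent_insert)
      moreover have "card (insert v (u ` ?S)) = d + 2"
      proof -
        have "v \<notin> u ` ?S"
          using v span_base by blast
        then show ?thesis
          using fin inj_u card by (simp add: card_image)
      qed
      ultimately show False
        using card_independent_le by fastforce
    qed
    then obtain c where "v = (\<Sum>w\<in>u ` ?S. sc (c w) w)"
      using fin by (auto simp: span_finite)
    then show ?thesis
      using inj_u by (auto simp: sum.reindex)
  qed
  let ?\<theta> = "\<lambda>h. associated_eigenvalue scale X (E h)"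
  have E: "bij_betw E {0..d} (?e ` ?S)"
    using ord by (simp add: idempotent_ordering_def)
  have assoc: "associated_eigenvalue scale X (?e \<xi>) = \<xi>" if "\<xi> \<in> ?S" for \<xi>
    unfolding associated_eigenvalue_def
    using that inj_onD[OF inj_e] by (intro the_equality) auto
  have \<theta>: "?\<theta> i \<in> ?S \<and> E i = ?e (?\<theta> i)" if "i \<le> d" for i
    using bij_betwE[OF E] that assoc by (metis (no_types, lifting) atLeastAtMost_iff imageE le0)
  have bij: "bij_betw ?\<theta> {0..d} ?S"
  proof -
    have "bij_betw (associated_eigenvalue scale X) (?e ` ?S) ?S"
      by (rule bij_betw_byWitness[where f' = ?e]) (auto simp: assoc)
    from bij_betw_trans[OF E this] show ?thesis
      by (simp add: comp_def)
  qed
  have inj: "inj_on ?\<theta> {..d}"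
    using bij by (simp add: bij_betw_def atLeast0AtMost)
  show ?thesis
  proof (intro spectral_resolution.intro spectral_resolution_axioms.intro vector_space_axioms hom_act inj)
    fix i assume i: "i \<le> d"
    have \<theta>i: "?\<theta> i \<in> ?S" "E i = ?e (?\<theta> i)"
      using \<theta>[OF i] by auto
    have Ei: "act (E i) (\<Sum>\<zeta>\<in>?S. sc (c \<zeta>) (u \<zeta>)) = sc (c (?\<theta> i)) (u (?\<theta> i))" for c
      using e_sum[OF \<theta>i(1)] \<theta>i(2) by simp
    have Eu: "act (E i) (u \<zeta>) = (if ?\<theta> i = \<zeta> then u \<zeta> else 0)" if "\<zeta> \<in> ?S" for \<zeta>
      using eu[OF \<theta>i(1) that] \<theta>i(2) by simp
    show "act (E i) (act X x) = sc (?\<theta> i) (act (E i) x)" for x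
    proof -
      obtain c where x: "x = (\<Sum>\<zeta>\<in>?S. sc (c \<zeta>) (u \<zeta>))"
        using expand by blast
      have "act X x = (\<Sum>\<zeta>\<in>?S. sc (c \<zeta> * \<zeta>) (u \<zeta>))"
        unfolding x act_sum_right by (intro sum.cong) (simp_all add: act_sc[of X] u)
      then have "act (E i) (act X x) = sc (c (?\<theta> i) * ?\<theta> i) (u (?\<theta> i))"
        by (simp only: Ei)
      then show ?thesis
        unfolding x Ei by (simp add: mult.commute)
    qed
    show "\<exists>x. act (E i) x \<noteq> 0"
      using Eu[OF \<theta>i(1)] u(1)[OF \<theta>i(1)] by (intro exI[of _ "u (?\<theta> i)"]) simp
    show "\<exists>c. act (E i) y = sc c (act (E i) x)" if "act (E i) x \<noteq> 0" for x y
    proof -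
      obtain c where x: "x = (\<Sum>\<zeta>\<in>?S. sc (c \<zeta>) (u \<zeta>))"
        using expand by blast
      obtain c' where y: "y = (\<Sum>\<zeta>\<in>?S. sc (c' \<zeta>) (u \<zeta>))"
        using expand by blast
      have "c (?\<theta> i) \<noteq> 0"
        using that unfolding x Ei by auto
      then have "act (E i) y = sc (c' (?\<theta> i) / c (?\<theta> i)) (act (E i) x)"
        unfolding x y Ei by simp
      then show ?thesis by blast
    qed
    show "act (E i) (act (E j) x) = (if i = j then act (E i) x else 0)" if j: "j \<le> d" for j x
    proof -
      obtain c where x: "x = (\<Sum>\<zeta>\<in>?S. sc (c \<zeta>) (u \<zeta>))"
        using expand by blast
      have \<theta>j: "?\<theta> j \<in> ?S" "E j = ?e (?\<theta> j)"
        using \<theta>[OF j] by auto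
      have "act (E j) x = sc (c (?\<theta> j)) (u (?\<theta> j))"
        unfolding x using e_sum[OF \<theta>j(1)] \<theta>j(2) by simp
      then have "act (E i) (act (E j) x) = (if ?\<theta> i = ?\<theta> j then act (E j) x else 0)"
        by (simp add: act_sc[of "E i"] Eu[OF \<theta>j(1)])
      then show ?thesis
        using inj_onD[OF inj, of i j] i j by auto
    qed
  next
    fix x
    obtain c where x: "x = (\<Sum>\<zeta>\<in>?S. sc (c \<zeta>) (u \<zeta>))"
      using expand by blast
    have "(\<Sum>i=0..d. act (E i) x) = (\<Sum>i=0..d. sc (c (?\<theta> i)) (u (?\<theta> i)))"
      unfolding x
    proof (intro sum.cong refl)
      fix i assume "i \<in> {0..d}"
      then have "?\<theta> i \<in> ?S" "E i = ?e (?\<theta> i)"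
        using \<theta>[of i] by auto
      then show "act (E i) (\<Sum>\<zeta>\<in>?S. sc (c \<zeta>) (u \<zeta>)) = sc (c (?\<theta> i)) (u (?\<theta> i))"
        using e_sum[of "?\<theta> i" c] by simp
    qed
    also have "\<dots> = x"
      unfolding x by (rule sum.reindex_bij_betw[OF bij])
    finally show "(\<Sum>i=0..d. act (E i) x) = x" .
  qed
qed

section \<open>From Leonard systems to Leonard pairs and their bases\<close>

lemma leonard_pair_act:
  assumes "leonard_system d scale A E As Es"
  shows "leonard_pair sc d
    (act A) (\<lambda>h. associated_eigenvalue scale A (E h)) (\<lambda>h. act (E h))
    (act As) (\<lambda>h. associated_eigenvalue scale As (Es h)) (\<lambda>h. act (Es h))"
proof -
  have tri: "tridiagonal_action d (act Y) (\<lambda>h. act (F h))"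
    if mf: "multiplicity_free d scale X" and ord: "idempotent_ordering d scale X F"
      and zero: "\<And>i j. i \<le> d \<Longrightarrow> j \<le> d \<Longrightarrow> \<bar>int i - int j\<bar> > 1 \<Longrightarrow> F i * Y * F j = 0"
      and nonzero: "\<And>i j. i \<le> d \<Longrightarrow> j \<le> d \<Longrightarrow> \<bar>int i - int j\<bar> = 1 \<Longrightarrow> F i * Y * F j \<noteq> 0"
    for X Y F
    unfolding tridiagonal_action_def
  proof (intro allI impI conjI)
    interpret R: spectral_resolution sc d "act X" "\<lambda>h. associated_eigenvalue scale X (F h)" "\<lambda>h. act (F h)"
      by (rule spectral_resolution_primitive_idempotents[OF mf ord])
    fix i j x assume ij: "i \<le> d" "j \<le> d"
    show "act (F i) (act Y (act (F j) x)) = 0" if "Suc i < j \<or> Suc j < i"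
    proof -
      have "\<bar>int i - int j\<bar> > 1" using that by auto
      then have "act (F i * Y * F j) x = 0"
        by (simp only: zero[OF ij] act_0_left)
      then show ?thesis by (simp add: act_simps)
    qed
    assume "i = Suc j \<or> j = Suc i" and nz: "act (F j) x \<noteq> 0"
    then have "\<bar>int i - int j\<bar> = 1" by auto
    \<comment> \<open>Faithfulness provides one vector \<open>v\<close> on which the product acts
      nontrivially. As \<open>F j\<close> has rank one, \<open>F j v\<close> is a multiple of
      \<open>F j x\<close>, which carries the nonvanishing over to \<open>x\<close>.\<close>
    then obtain v where v: "act (F i * Y * F j) v \<noteq> 0"
      using faithful[OF nonzero[OF ij]] by blast
    obtain c where "act (F j) v = sc c (act (F j) x)"
      using R.proj_rank_one[OF ij(2) nz] by blast
    then have "act (F i * Y * F j) v = sc c (act (F i) (act Y (act (F j) x)))"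
      by (simp add: act_simps act_sc[of Y] act_sc[of "F i"])
    with v show "act (F i) (act Y (act (F j) x)) \<noteq> 0"
      by auto
  qed
  show ?thesis
    using assms unfolding leonard_system_def
    by (intro leonard_pair.intro leonard_pair_axioms.intro spectral_resolution_primitive_idempotents
        tri[of A] tri[of As]) auto
qed

lemma rep_matrix_eq: "rep_matrix d scale act v X = matrix_of d sc v (act X)"
  by (simp add: rep_matrix_def matrix_of_def)

lemma act_prod_list:
  "act (\<Prod>h\<leftarrow>hs. X - scale (\<theta> h) 1) v = foldr (\<lambda>c x. act X x - sc c x) (map \<theta> hs) v"
  by (induction hs) (simp_all add: act_simps act_minus_left)

text \<open>These are the six bases built from one end vector: \<open>\<tau>\<close>,
  \<open>\<sigma>\<close> and the eigenbasis, each in both orders. \<open>X\<close> is the element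
  whose products or idempotents are applied, so either \<open>A\<close> or \<open>As\<close> can
  stand for it.\<close>

lemma rep_matrix_bases:
  assumes "leonard_pair sc d (act X) \<theta> (\<lambda>h. act (F h)) (act Y) \<phi> Q"
    and \<eta>: "Q 0 \<eta> = \<eta>" "\<eta> \<noteq> 0"
  defines "rep \<equiv> rep_matrix d scale act"
    and "t \<equiv> tau scale \<theta> X" and "s \<equiv> sigma d scale \<theta> X"
  shows "lower_bidiagonal (rep (\<lambda>i. act (t i) \<eta>) X)"
    and "upper_bidiagonal (rep (\<lambda>i. act (t i) \<eta>) Y)"
    and "upper_bidiagonal (rep (\<lambda>i. act (t (d - i)) \<eta>) X)"
    and "lower_bidiagonal (rep (\<lambda>i. act (t (d - i)) \<eta>) Y)"
    and "lower_bidiagonal (rep (\<lambda>i. act (s i) \<eta>) X)"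
    and "upper_bidiagonal (rep (\<lambda>i. act (s i) \<eta>) Y)"
    and "upper_bidiagonal (rep (\<lambda>i. act (s (d - i)) \<eta>) X)"
    and "lower_bidiagonal (rep (\<lambda>i. act (s (d - i)) \<eta>) Y)"
    and "diagonal_mat (rep (\<lambda>i. act (F i) \<eta>) X)"
    and "irreducible_tridiagonal (rep (\<lambda>i. act (F i) \<eta>) Y)"
    and "diagonal_mat (rep (\<lambda>i. act (F (d - i)) \<eta>) X)"
    and "irreducible_tridiagonal (rep (\<lambda>i. act (F (d - i)) \<eta>) Y)"
proof -
  interpret L: leonard_pair sc d "act X" \<theta> "\<lambda>h. act (F h)" "act Y" \<phi> Q
    by (rule assms(1))
  have t: "split_basis d (\<lambda>h. act (F h)) Q (\<lambda>i. act (t i) \<eta>)"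
    unfolding t_def tau_def act_prod_list by (rule L.split_basis_tau[OF \<eta>])
  have s: "split_basis d (\<lambda>h. act (F (d - h))) Q (\<lambda>i. act (s i) \<eta>)"
    unfolding s_def sigma_def act_prod_list by (rule L.split_basis_sigma[OF \<eta>])
  note R = L.reverse_left
  show "lower_bidiagonal (rep (\<lambda>i. act (t i) \<eta>) X)"
    and "upper_bidiagonal (rep (\<lambda>i. act (t i) \<eta>) Y)"
    and "upper_bidiagonal (rep (\<lambda>i. act (t (d - i)) \<eta>) X)"
    and "lower_bidiagonal (rep (\<lambda>i. act (t (d - i)) \<eta>) Y)"
    unfolding rep_def rep_matrix_eq
    using L.bidiagonal_split_basis[OF t] L.bidiagonal_reverse[OF t] by auto
  show "lower_bidiagonal (rep (\<lambda>i. act (s i) \<eta>) X)"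
    and "upper_bidiagonal (rep (\<lambda>i. act (s i) \<eta>) Y)"
    and "upper_bidiagonal (rep (\<lambda>i. act (s (d - i)) \<eta>) X)"
    and "lower_bidiagonal (rep (\<lambda>i. act (s (d - i)) \<eta>) Y)"
    unfolding rep_def rep_matrix_eq
    using leonard_pair.bidiagonal_split_basis[OF R s] leonard_pair.bidiagonal_reverse[OF R s]
    by auto
  show "diagonal_mat (rep (\<lambda>i. act (F i) \<eta>) X)"
    and "irreducible_tridiagonal (rep (\<lambda>i. act (F i) \<eta>) Y)"
    and "diagonal_mat (rep (\<lambda>i. act (F (d - i)) \<eta>) X)"
    and "irreducible_tridiagonal (rep (\<lambda>i. act (F (d - i)) \<eta>) Y)"
    unfolding rep_def rep_matrix_eq
    using L.eigenbasis[OF \<eta>] leonard_pair.eigenbasis[OF R \<eta>] by auto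
qed

end

section \<open>The 24 orderings: matching them with the bases and counting\<close>

lemma card_Collect_eq_length_filter:
  assumes "distinct xs" "set xs = UNIV"
  shows "card {x. R x} = length (filter R xs)"
  using assms distinct_card[of "filter R xs"] by simp

text \<open>Turns a cardinality over quadruples of symbols into the length of a filtered explicit
  list, which can be evaluated.\<close>

lemma card_Collect_symb4:
  "card {g :: symb \<times> symb \<times> symb \<times> symb. R g} = length (filter R
     (let ss = [S0, Sd, S0s, Sds] in
       List.product ss (List.product ss (List.product ss ss))))"
proof (rule card_Collect_eq_length_filter)
  have "s \<in> set [S0, Sd, S0s, Sds]" for s
    by (cases s) simp_all
  then have UNIV: "set [S0, Sd, S0s, Sds] = UNIV"
    by (rule UNIV_eq_I[symmetric])
  show "set (let ss = [S0, Sd, S0s, Sds] in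
      List.product ss (List.product ss (List.product ss ss))) = UNIV"
    unfolding Let_def set_product UNIV by simp
  show "distinct (let ss = [S0, Sd, S0s, Sds] in
      List.product ss (List.product ss (List.product ss ss)))"
    unfolding Let_def by (intro distinct_product) auto
qed

theorem lemma11p3:
  fixes d :: nat
    and scale :: "'k::field \<Rightarrow> 'a::ring_1 \<Rightarrow> 'a"
    and act :: "'a \<Rightarrow> 'v::ab_group_add \<Rightarrow> 'v"
    and A As :: 'a and E Es :: "nat \<Rightarrow> 'a"
    and \<eta>0 \<eta>d \<eta>0s \<eta>ds :: 'v
  assumes "full_matrix_algebra d scale"
    and "irreducible_left_module act"
    and "leonard_system d scale A E As Es"
    and "\<eta>0 \<in> range (act (E 0))" "\<eta>0 \<noteq> 0"
    and "\<eta>d \<in> range (act (E d))" "\<eta>d \<noteq> 0"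
    and "\<eta>0s \<in> range (act (Es 0))" "\<eta>0s \<noteq> 0"
    and "\<eta>ds \<in> range (act (Es d))" "\<eta>ds \<noteq> 0"
  shows "(\<forall>w x y z. (w, x, y, z) \<in> S4 \<longrightarrow>
      (let v = basis_vec d scale act A E As Es \<eta>0 \<eta>d \<eta>0s \<eta>ds (w, x, y, z);
           Ag = rep_matrix d scale act v A;
           Asg = rep_matrix d scale act v As
       in (y \<notin> {S0s, Sds} \<and> z \<notin> {S0s, Sds} \<longrightarrow>
             diagonal_mat Ag \<and> irreducible_tridiagonal Asg) \<and>
          (y \<in> {S0s, Sds} \<and> z \<notin> {S0s, Sds} \<longrightarrow>
             lower_bidiagonal Ag \<and> upper_bidiagonal Asg) \<and>
          (y \<notin> {S0s, Sds} \<and> z \<in> {S0s, Sds} \<longrightarrow>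
             upper_bidiagonal Ag \<and> lower_bidiagonal Asg) \<and>
          (y \<in> {S0s, Sds} \<and> z \<in> {S0s, Sds} \<longrightarrow>
             irreducible_tridiagonal Ag \<and> diagonal_mat Asg))) \<and>
    card {(w, x, y, z) \<in> S4. y \<notin> {S0s, Sds} \<and> z \<notin> {S0s, Sds}} = 4 \<and>
    card {(w, x, y, z) \<in> S4. y \<in> {S0s, Sds} \<and> z \<notin> {S0s, Sds}} = 8 \<and>
    card {(w, x, y, z) \<in> S4. y \<notin> {S0s, Sds} \<and> z \<in> {S0s, Sds}} = 8 \<and>
    card {(w, x, y, z) \<in> S4. y \<in> {S0s, Sds} \<and> z \<in> {S0s, Sds}} = 4"
proof -
  interpret irreducible_matrix_module d scale act
    by unfold_locales (rule assms)+
  let ?\<theta> = "\<lambda>h. associated_eigenvalue scale A (E h)"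
  let ?\<theta>s = "\<lambda>h. associated_eigenvalue scale As (Es h)"
  interpret L: leonard_pair sc d "act A" ?\<theta> "\<lambda>h. act (E h)" "act As" ?\<theta>s "\<lambda>h. act (Es h)"
    by (rule leonard_pair_act[OF assms(3)])
  \<comment> \<open>A vector in the range of an idempotent is fixed by it. The form
    \<open>d - 0\<close> matches \<open>Q 0\<close> of the reversed pairs.\<close>
  have \<eta>: "act (E 0) \<eta>0 = \<eta>0" "act (E (d - 0)) \<eta>d = \<eta>d"
    "act (Es 0) \<eta>0s = \<eta>0s" "act (Es (d - 0)) \<eta>ds = \<eta>ds"
    using assms(4,6,8,10) by (auto simp: L.P.proj_proj L.Q.proj_proj)
  \<comment> \<open>One family per end vector, in the order \<open>\<eta>0s\<close>,
    \<open>\<eta>ds\<close>, \<open>\<eta>0\<close>, \<open>\<eta>d\<close>. Only the order on the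
    \<open>Q\<close> side is ever reversed, so the products and idempotents applied keep their
    original indexing.\<close>
  note bases =
    rep_matrix_bases[OF L.leonard_pair_axioms \<eta>(3) assms(9)]
    rep_matrix_bases[OF L.reverse_right \<eta>(4) assms(11)]
    rep_matrix_bases[OF L.swap \<eta>(1) assms(5)]
    rep_matrix_bases[OF leonard_pair.reverse_right[OF L.swap] \<eta>(2) assms(7)]
  show ?thesis
  proof (intro conjI allI impI)
    fix w x y z assume "(w, x, y, z) \<in> S4"
    then show "let v = basis_vec d scale act A E As Es \<eta>0 \<eta>d \<eta>0s \<eta>ds (w, x, y, z);
           Ag = rep_matrix d scale act v A;
           Asg = rep_matrix d scale act v As
       in (y \<notin> {S0s, Sds} \<and> z \<notin> {S0s, Sds} \<longrightarrow>
             diagonal_mat Ag \<and> irreducible_tridiagonal Asg) \<and>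
          (y \<in> {S0s, Sds} \<and> z \<notin> {S0s, Sds} \<longrightarrow>
             lower_bidiagonal Ag \<and> upper_bidiagonal Asg) \<and>
          (y \<notin> {S0s, Sds} \<and> z \<in> {S0s, Sds} \<longrightarrow>
             upper_bidiagonal Ag \<and> lower_bidiagonal Asg) \<and>
          (y \<in> {S0s, Sds} \<and> z \<in> {S0s, Sds} \<longrightarrow>
             irreducible_tridiagonal Ag \<and> diagonal_mat Asg)"
      \<comment> \<open>Of the 256 quadruples the first simplification discards all but the 24
        orderings; each remaining basis unfolds to one listed in \<open>bases\<close>.\<close>
      by (cases w; cases x; cases y; cases z;
          simp only: S4_def mem_Collect_eq prod.case distinct.simps list.set insert_iff
            symb.distinct simp_thms empty_iff;
          simp only: Let_def basis_vec_def[abs_def] prod.case symb.case;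
          simp add: bases)
  qed (unfold card_Collect_symb4 S4_def mem_Collect_eq, code_simp+)
qed

end
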